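(* Let $H\in\,]\frac14,\frac12[$ and let $h=K\dot h$ be an element of the reproducing kernel Hilbert space $\mathcal{H}$ of the $d$-dimensional fractional Brownian motion with Hurst parameter $H$, with components $h^i$ and $\dot h^i$, $i=1,\dots,d$. Let $(1,h^1,h^2,h^3)$ be the geometric rough path lying above $h$. Then for every $0\le s<t\le1$ and $i,j,\kappa\in\{1,\dots,d\}$, $$h^{2,i,j}_{s,t}=\int_0^1K^*\left(h^{1,i}_{0,\cdot}\mathbf{1}_{]s,t]}\right)(u)\,\dot h^j(u)\,du-h^{1,i}_{0,s}h^{1,j}_{s,t},$$ $$h^{3,i,j,\kappa}_{s,t}=\int_0^1K^*\left(h^{2,i,j}_{0,\cdot}\mathbf{1}_{]s,t]}\right)(u)\,\dot h^\kappa(u)\,du-h^{2,i,j}_{0,s}h^{1,\kappa}_{s,t}-h^{1,i}_{0,s}h^{2,j,\kappa}_{s,t}.$$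
   Context: Kernel and space: for $0<s<t\le1$, $$K(t,s)=c_H(t-s)^{H-\frac12}+c_H\left(\tfrac12-H\right)\int_s^t(u-s)^{H-\frac32}\left(1-\left(\tfrac su\right)^{\frac12-H}\right)du,$$ and $K(t,s)=0$ for $s\ge t$, where $c_H>0$ is the normalizing constant for which $\int_0^1K(t,r)K(s,r)\,dr=\frac12(s^{2H}+t^{2H}-|t-s|^{2H})$. For $r>s>0$, $\frac{\partial K}{\partial r}(r,s)=c_H(H-\frac12)(\frac sr)^{\frac12-H}(r-s)^{H-\frac32}$, and $K(dr,s)=\frac{\partial K}{\partial r}(r,s)\mathbf{1}_{]s,1[}(r)\,dr$. $\mathcal{H}$ is the set of $h:[0,1]\to\mathbb{R}^d$ of the form $h(t)=(K\dot h)(t)=\int_0^tK(t,s)\dot h(s)\,ds$, $\dot h\in L^2([0,1];\mathbb{R}^d)$. Operator $K^*$: for $\varphi:[0,1]\to\mathbb{R}$ and $t\in[0,1]$, $$K^*(\varphi\mathbf{1}_{[0,t]})(u)=\varphi(u)K(t,u)+\int_u^t(\varphi(r)-\varphi(u))K(dr,u)\quad\text{for }u<t,$$ and $K^*(\varphi\mathbf{1}_{[0,t]})(u)=0$ for $u\ge t$; moreover $K^*(\varphi\mathbf{1}_{]s,t]})=K^*(\varphi\mathbf{1}_{[0,t]})-K^*(\varphi\mathbf{1}_{[0,s]})$. Rough path above $h$: let $h(m)$ be the linear interpolation of $h$ on the dyadic grid $(l2^{-m})_{0\le l\le2^m}$ and, for $0\le s\le t\le1$ and $j=1,2,3$, let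 $h(m)^j_{s,t}=\int\cdots\int_{s<t_1<\cdots<t_j<t}dh(m)_{t_1}\otimes\cdots\otimes dh(m)_{t_j}$. The geometric rough path lying above $h$ is the limit as $m\to\infty$ of $(1,h(m)^1,h(m)^2,h(m)^3)$ in the $p$-variation distance $$d_p(X,Y)=\max_{1\le j\le[p]}\left(\sup_{\mathcal{P}}\sum_l|X^j_{t_{l-1},t_l}-Y^j_{t_{l-1},t_l}|^{p/j}\right)^{j/p}$$ (supremum over finite partitions of $[0,1]$), for $p\in\,]1,4[$ with $pH>1$; in particular $h^j_{s,t}=\lim_{m\to\infty}h(m)^j_{s,t}$ for $j=1,2,3$, and $h^1_{s,t}=h(t)-h(s)$. (The existence of this limit is established beforehand.) $h^{2,i,j}$ and $h^{3,i,j,\kappa}$ denote the components of the tensors $h^2$ and $h^3$. *)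

theory Defs
  imports "HOL-Analysis.Analysis"
begin

subsection \<open>The Volterra kernel of fractional Brownian motion\<close>

text \<open>
  The kernel is used only for \<open>0 \<le> s\<close>. At \<open>s = 0\<close>, where the formula is not prescribed, it is set
  to \<open>0\<close>; only values for almost every \<open>s\<close> matter.
\<close>

definition volterra_kernel :: "real \<Rightarrow> real \<Rightarrow> real \<Rightarrow> real \<Rightarrow> real" where
  "volterra_kernel c H t s =
     (if 0 < s \<and> s < t
      then c * (t - s) powr (H - 1/2)
           + c * (1/2 - H) *
             (LINT u:{s..t}|lebesgue. (u - s) powr (H - 3/2) * (1 - (s / u) powr (1/2 - H)))
      else 0)"

definition fbm_const :: "real \<Rightarrow> real" where
  "fbm_const H =
     (THE c. c > 0 \<and>
        (\<forall>s\<in>{0..1}. \<forall>t\<in>{0..1}.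
           (LINT r:{0..1}|lebesgue. volterra_kernel c H t r * volterra_kernel c H s r) =
           (1/2) * (s powr (2 * H) + t powr (2 * H) - \<bar>t - s\<bar> powr (2 * H))))"

definition fbm_kernel :: "real \<Rightarrow> real \<Rightarrow> real \<Rightarrow> real" where
  "fbm_kernel H = volterra_kernel (fbm_const H) H"

text \<open>Density with respect to \<open>dr\<close> of the measure \<open>K(dr, s)\<close>.\<close>

definition fbm_kernel_density :: "real \<Rightarrow> real \<Rightarrow> real \<Rightarrow> real" where
  "fbm_kernel_density H r s = deriv (\<lambda>x. fbm_kernel H x s) r * indicator {s<..<1} r"


subsection \<open>The reproducing kernel Hilbert space\<close>

text \<open>
  Functions on \<open>[0,1]\<close> are represented by functions on the reals whose values outside \<open>[0,1]\<close> are
  irrelevant. The space consists of the \<open>h\<close> that agree on \<open>[0,1]\<close> with \<open>fbm_operator H g\<close> for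
  some \<open>g \<in> L2_unit\<close>.
\<close>

definition L2_unit :: "(real \<Rightarrow> real ^ 'd) set" where
  "L2_unit = {g. set_borel_measurable lebesgue {0..1} g \<and>
                 set_integrable lebesgue {0..1} (\<lambda>u. (norm (g u))\<^sup>2)}"

definition fbm_operator :: "real \<Rightarrow> (real \<Rightarrow> real ^ 'd) \<Rightarrow> real \<Rightarrow> real ^ 'd" where
  "fbm_operator H g t = (LINT s:{0..t}|lebesgue. fbm_kernel H t s *\<^sub>R g s)"


subsection \<open>The operator \<open>K\<^sup>*\<close>\<close>

text \<open>\<open>Kstar_upto H \<phi> t\<close> is \<open>K\<^sup>* (\<phi> 1\<^bsub>[0,t]\<^esub>)\<close> and \<open>Kstar_between H \<phi> s t\<close> is \<open>K\<^sup>* (\<phi> 1\<^bsub>]s,t]\<^esub>)\<close>.\<close>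

definition Kstar_upto :: "real \<Rightarrow> (real \<Rightarrow> real) \<Rightarrow> real \<Rightarrow> real \<Rightarrow> real" where
  "Kstar_upto H \<phi> t u =
     (if u < t
      then \<phi> u * fbm_kernel H t u
           + (LINT r:{u..t}|lebesgue. (\<phi> r - \<phi> u) * fbm_kernel_density H r u)
      else 0)"

definition Kstar_between :: "real \<Rightarrow> (real \<Rightarrow> real) \<Rightarrow> real \<Rightarrow> real \<Rightarrow> real \<Rightarrow> real" where
  "Kstar_between H \<phi> s t u = Kstar_upto H \<phi> t u - Kstar_upto H \<phi> s u"


subsection \<open>Three-level rough paths\<close>

text \<open>
  Tensors of order two and three over \<open>real ^ 'd\<close> are given by their components in the canonical
  basis, so that \<open>norm\<close> is the Euclidean (Hilbert-Schmidt) norm. The scalar component \<open>1\<close> of a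
  rough path is left implicit.
\<close>

record ('d::finite) rough_path =
  level1 :: "real \<Rightarrow> real \<Rightarrow> real ^ 'd"
  level2 :: "real \<Rightarrow> real \<Rightarrow> real ^ 'd ^ 'd"
  level3 :: "real \<Rightarrow> real \<Rightarrow> real ^ 'd ^ 'd ^ 'd"

definition tensor2 :: "real ^ 'd \<Rightarrow> real ^ 'd \<Rightarrow> real ^ 'd ^ 'd" where
  "tensor2 x y = (\<chi> i j. x $ i * y $ j)"

definition tensor3 :: "real ^ 'd ^ 'd \<Rightarrow> real ^ 'd \<Rightarrow> real ^ 'd ^ 'd ^ 'd" where
  "tensor3 x y = (\<chi> i j k. x $ i $ j * y $ k)"

text \<open>
  Iterated integrals over \<open>s < t\<^sub>1 < \<dots> < t\<^sub>j < t\<close>, the integrator \<open>dx\<close> being \<open>x' dt\<close>. They are used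
  only for piecewise linear \<open>x\<close>, which is differentiable off a finite set.
\<close>

definition iterated_integral1 :: "(real \<Rightarrow> real ^ 'd) \<Rightarrow> real \<Rightarrow> real \<Rightarrow> real ^ 'd" where
  "iterated_integral1 x s t =
     (LINT r:{s<..<t}|lebesgue. vector_derivative x (at r))"

definition iterated_integral2 :: "(real \<Rightarrow> real ^ 'd) \<Rightarrow> real \<Rightarrow> real \<Rightarrow> real ^ 'd ^ 'd" where
  "iterated_integral2 x s t =
     (LINT r:{s<..<t}|lebesgue. tensor2 (iterated_integral1 x s r) (vector_derivative x (at r)))"

definition iterated_integral3 :: "(real \<Rightarrow> real ^ 'd) \<Rightarrow> real \<Rightarrow> real \<Rightarrow> real ^ 'd ^ 'd ^ 'd" where
  "iterated_integral3 x s t =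
     (LINT r:{s<..<t}|lebesgue. tensor3 (iterated_integral2 x s r) (vector_derivative x (at r)))"

definition canonical_lift :: "(real \<Rightarrow> real ^ 'd) \<Rightarrow> 'd rough_path" where
  "canonical_lift x =
     \<lparr>level1 = iterated_integral1 x, level2 = iterated_integral2 x, level3 = iterated_integral3 x\<rparr>"

definition dyadic_interpolation :: "(real \<Rightarrow> real ^ 'd) \<Rightarrow> nat \<Rightarrow> real \<Rightarrow> real ^ 'd" where
  "dyadic_interpolation h m t =
     (let l = \<lfloor>t * 2 ^ m\<rfloor> in
      h (l / 2 ^ m) + (t * 2 ^ m - l) *\<^sub>R (h ((l + 1) / 2 ^ m) - h (l / 2 ^ m)))"


subsection \<open>The \<open>p\<close>-variation distance\<close>

definition unit_partitions :: "(nat \<times> (nat \<Rightarrow> real)) set" where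
  "unit_partitions = {(n, \<tau>). \<tau> 0 = 0 \<and> \<tau> n = 1 \<and> (\<forall>l<n. \<tau> l < \<tau> (Suc l))}"

definition ennreal_powr :: "ennreal \<Rightarrow> real \<Rightarrow> ennreal" where
  "ennreal_powr x a = (if x = \<infinity> then \<infinity> else ennreal (enn2real x powr a))"

text \<open>The contribution of a single level, with exponent \<open>q = p / j\<close>.\<close>

definition variation_dist ::
    "real \<Rightarrow> (real \<Rightarrow> real \<Rightarrow> 'a::real_normed_vector) \<Rightarrow> (real \<Rightarrow> real \<Rightarrow> 'a) \<Rightarrow> ennreal" where
  "variation_dist q X Y =
     ennreal_powr
       (SUP (n, \<tau>) \<in> unit_partitions.
          \<Sum>l = 1..n. ennreal (norm (X (\<tau> (l - 1)) (\<tau> l) - Y (\<tau> (l - 1)) (\<tau> l)) powr q))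
       (1 / q)"

definition level_dist :: "real \<Rightarrow> 'd::finite rough_path \<Rightarrow> 'd rough_path \<Rightarrow> nat \<Rightarrow> ennreal" where
  "level_dist p X Y j =
     (if j = 1 then variation_dist p (level1 X) (level1 Y)
      else if j = 2 then variation_dist (p / 2) (level2 X) (level2 Y)
      else if j = 3 then variation_dist (p / 3) (level3 X) (level3 Y)
      else 0)"

text \<open>Meaningful for \<open>1 \<le> p < 4\<close>, since only three levels are present.\<close>

definition rough_dist :: "real \<Rightarrow> 'd::finite rough_path \<Rightarrow> 'd rough_path \<Rightarrow> ennreal" where
  "rough_dist p X Y = Max (level_dist p X Y ` {1..nat \<lfloor>p\<rfloor>})"

text \<open>
  For \<open>p < 3\<close> the distance does not see the third level, which is then determined by the
  pointwise limits; for the levels up to \<open>\<lfloor>p\<rfloor>\<close> these follow from the first conjunct.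
\<close>

definition geometric_rough_path_above ::
    "real \<Rightarrow> (real \<Rightarrow> real ^ 'd) \<Rightarrow> 'd::finite rough_path \<Rightarrow> bool" where
  "geometric_rough_path_above p h X \<longleftrightarrow>
     (\<lambda>m. rough_dist p (canonical_lift (dyadic_interpolation h m)) X) \<longlonglongrightarrow> 0 \<and>
     (\<forall>s t. 0 \<le> s \<and> s \<le> t \<and> t \<le> 1 \<longrightarrow>
        (\<lambda>m. level1 (canonical_lift (dyadic_interpolation h m)) s t) \<longlonglongrightarrow> level1 X s t \<and>
        (\<lambda>m. level2 (canonical_lift (dyadic_interpolation h m)) s t) \<longlonglongrightarrow> level2 X s t \<and>
        (\<lambda>m. level3 (canonical_lift (dyadic_interpolation h m)) s t) \<longlonglongrightarrow> level3 X s t)"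

end

theory Submission
  imports Defs
begin

text \<open>
  Both sides are homogeneous in the normalizing constant, which is absorbed into \<open>hdot\<close>, and Chen's
  relation reduces the formulas to \<open>s = 0\<close>.

  Put \<open>a = 1/2 - H < 1/4\<close>. The integral of \<open>f\<close> against the dyadic interpolation of \<open>y = K g\<close> up to a
  dyadic time equals \<open>\<integral> K\<^sup>* \<sigma> g\<close>, where the step function \<open>\<sigma>\<close> takes the dyadic means of \<open>f\<close>. If \<open>f\<close> is
  Hoelder continuous of exponent \<open>H\<close>, then \<open>f\<close> and \<open>f - \<sigma>\<close> satisfy an oscillation condition under which
  the increments in time of \<open>K\<^sup>* f\<close> and of \<open>K\<^sup>* (f - \<sigma>)\<close> have \<open>L\<^sup>2\<close> norm at most a multiple of
  \<open>\<bar>t' - t\<bar> powr H\<close>, and for \<open>f - \<sigma>\<close> the factor tends to \<open>0\<close> with the mesh. Hence these integrals are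
  Hoelder continuous of exponent \<open>H\<close> uniformly in the mesh and converge to \<open>\<integral> K\<^sup>* f g\<close>. Starting from
  \<open>f = 1\<close>, the uniform estimate at one level of the lifts is what makes the next level accessible.
\<close>

section \<open>The kernel and its derivative\<close>

text \<open>Two functions of Hoelder exponent \<open>H < 1/2\<close> are out of reach of Young's
  integral. Convergence rests instead on the square integrability of \<open>g\<close>: duality puts
  \<open>K\<^sup>*\<close> on the integrand and leaves an \<open>L^2\<close> estimate. This operator
  integrates increments of its argument against a density of size
  \<open>(r - u) powr (- a - 1)\<close>, which converges for Hoelder exponents above
  \<open>a\<close>; a step function violates this at every grid point. With mesh
  \<open>\<delta>\<close>, the error \<open>f - \<sigma>\<close> jumps by at most a multiple of
  \<open>\<delta> powr (1/2 - a)\<close>. A jump at distance \<open>d\<close> to the right of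
  \<open>u\<close> costs a factor \<open>d powr (- a)\<close>, whose mean square over a cell is
  \<open>\<delta> powr (- 2 * a) / (1 - 2 * a)\<close>. So the jumps have \<open>L^2\<close> size of
  order \<open>\<delta> powr (1/2 - 2 * a)\<close>, which tends to \<open>0\<close> exactly when
  \<open>a < 1/4\<close>: this is the origin of \<open>H > 1/4\<close>. The bounds below share this
  power out between \<open>B = 2 * C * \<delta> powr (1/4 - a)\<close> and
  \<open>\<theta> = \<delta> powr (1/4)\<close>.\<close>

lemma set_integrable_lborel_of_nonneg_has_integral:
  fixes f :: "real \<Rightarrow> real"
  assumes "(f has_integral I) S" and "S \<in> sets borel" and "f \<in> borel_measurable borel"
    and "\<And>x. x \<in> S \<Longrightarrow> 0 \<le> f x"
  shows "set_integrable lborel S f" "(LINT x:S|lborel. f x) = I"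
proof -
  have "set_integrable lebesgue S f"
    using assms by (intro nonnegative_absolutely_integrable_1) (auto simp: has_integral_iff)
  then show int: "set_integrable lborel S f"
    using assms(2,3) unfolding set_integrable_def by (subst (asm) integrable_completion) auto
  show "(LINT x:S|lborel. f x) = I"
    using set_borel_integral_eq_integral(2)[OF int] assms(1) by (auto simp: has_integral_iff)
qed

text \<open>A singularity can sit only at an endpoint, where the primitive is still continuous
  because \<open>e + 1 > 0\<close>. The interior form of the fundamental theorem then gives the
  integral, and nonnegativity upgrades it to Lebesgue integrability.\<close>

lemma
  fixes x y z e :: real
  assumes "x \<le> z" "z \<le> y" and "-1 < e"
  shows set_integrable_powr_minus_left: "set_integrable lborel {z..y} (\<lambda>r. (r - x) powr e)"
    and LINT_powr_minus_left: "(LINT r:{z..y}|lborel. (r - x) powr e)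
           = (y - x) powr (e + 1) / (e + 1) - (z - x) powr (e + 1) / (e + 1)"
proof -
  have *: "((\<lambda>r. (r - x) powr e) has_integral
      (y - x) powr (e + 1) / (e + 1) - (z - x) powr (e + 1) / (e + 1)) {z..y}"
  proof (rule fundamental_theorem_of_calculus_interior[OF assms(2)])
    show "continuous_on {z..y} (\<lambda>r. (r - x) powr (e + 1) / (e + 1))"
      using assms by (intro continuous_intros continuous_on_powr') auto
    show "((\<lambda>r. (r - x) powr (e + 1) / (e + 1)) has_vector_derivative (r - x) powr e) (at r)"
      if "r \<in> {z<..<y}" for r
      using that assms unfolding has_real_derivative_iff_has_vector_derivative[symmetric]
      by (auto intro!: derivative_eq_intros simp: add_eq_0_iff)
  qed
  show "set_integrable lborel {z..y} (\<lambda>r. (r - x) powr e)"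
    and "(LINT r:{z..y}|lborel. (r - x) powr e)
           = (y - x) powr (e + 1) / (e + 1) - (z - x) powr (e + 1) / (e + 1)"
    by (rule set_integrable_lborel_of_nonneg_has_integral[OF *]; auto)+
qed

lemma
  fixes x y z e :: real
  assumes "x \<le> z" "z \<le> y" and "-1 < e"
  shows set_integrable_powr_minus_right: "set_integrable lborel {x..z} (\<lambda>r. (y - r) powr e)"
    and LINT_powr_minus_right: "(LINT r:{x..z}|lborel. (y - r) powr e)
           = (y - x) powr (e + 1) / (e + 1) - (y - z) powr (e + 1) / (e + 1)"
proof -
  have "((\<lambda>r. (y - r) powr e) has_integral
      - ((y - z) powr (e + 1) / (e + 1)) - - ((y - x) powr (e + 1) / (e + 1))) {x..z}"
  proof (rule fundamental_theorem_of_calculus_interior[OF assms(1)])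
    show "continuous_on {x..z} (\<lambda>r. - ((y - r) powr (e + 1) / (e + 1)))"
      using assms by (intro continuous_intros continuous_on_powr') auto
    show "((\<lambda>r. - ((y - r) powr (e + 1) / (e + 1))) has_vector_derivative (y - r) powr e) (at r)"
      if "r \<in> {x<..<z}" for r
      using that assms unfolding has_real_derivative_iff_has_vector_derivative[symmetric]
      by (auto intro!: derivative_eq_intros simp: add_eq_0_iff)
  qed
  then have *: "((\<lambda>r. (y - r) powr e) has_integral
      (y - x) powr (e + 1) / (e + 1) - (y - z) powr (e + 1) / (e + 1)) {x..z}"
    by simp
  show "set_integrable lborel {x..z} (\<lambda>r. (y - r) powr e)"
    and "(LINT r:{x..z}|lborel. (y - r) powr e)
           = (y - x) powr (e + 1) / (e + 1) - (y - z) powr (e + 1) / (e + 1)"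
    by (rule set_integrable_lborel_of_nonneg_has_integral[OF *]; auto)+
qed

text \<open>Here \<open>e\<close> may be below \<open>-1\<close>: the interval stays away from the singularity.\<close>

lemma
  fixes u x y e :: real
  assumes "u < x" "x \<le> y" and "e \<noteq> -1"
  shows set_integrable_powr_minus_off: "set_integrable lborel {x..y} (\<lambda>r. (r - u) powr e)"
    and LINT_powr_minus_off: "(LINT r:{x..y}|lborel. (r - u) powr e)
           = (y - u) powr (e + 1) / (e + 1) - (x - u) powr (e + 1) / (e + 1)"
proof -
  have *: "((\<lambda>r. (r - u) powr e) has_integral
      (y - u) powr (e + 1) / (e + 1) - (x - u) powr (e + 1) / (e + 1)) {x..y}"
  proof (rule fundamental_theorem_of_calculus[OF assms(2)])
    show "((\<lambda>r. (r - u) powr (e + 1) / (e + 1)) has_vector_derivative (r - u) powr e)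
            (at r within {x..y})"
      if "r \<in> {x..y}" for r
      using that assms unfolding has_real_derivative_iff_has_vector_derivative[symmetric]
      by (auto intro!: derivative_eq_intros simp: add_eq_0_iff)
  qed
  show "set_integrable lborel {x..y} (\<lambda>r. (r - u) powr e)"
    and "(LINT r:{x..y}|lborel. (r - u) powr e)
           = (y - u) powr (e + 1) / (e + 1) - (x - u) powr (e + 1) / (e + 1)"
    by (rule set_integrable_lborel_of_nonneg_has_integral[OF *]; auto)+
qed

text \<open>Subadditivity of a concave power, reduced to \<open>z \<le> z powr p\<close> on
  \<open>[0,1]\<close>: the fractions \<open>x / y\<close> and \<open>(y - x) / y\<close> add up to
  \<open>1\<close>.\<close>

lemma powr_diff_le:
  fixes x y p :: real
  assumes "0 \<le> x" "x \<le> y" "0 < p" "p \<le> 1"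
  shows "y powr p - x powr p \<le> (y - x) powr p"
proof (cases "x = y")
  case False
  then have y: "0 < y" "x < y" using assms by auto
  have *: "z \<le> z powr p" if "0 \<le> z" "z \<le> 1" for z :: real
    using powr_mono'[of p 1 z] that assms by simp
  have "x / y \<le> (x / y) powr p" "(y - x) / y \<le> ((y - x) / y) powr p"
    using assms y by (intro *; simp)+
  moreover have "x / y + (y - x) / y = 1"
    using y by (simp add: add_divide_distrib[symmetric])
  ultimately have "1 \<le> (x / y) powr p + ((y - x) / y) powr p" by linarith
  then have "y powr p * 1 \<le> y powr p * ((x / y) powr p + ((y - x) / y) powr p)"
    by (intro mult_left_mono) auto
  also have "\<dots> = x powr p + (y - x) powr p"
    using assms y by (simp add: powr_divide distrib_left)
  finally show ?thesis by simp
qed (use assms in auto)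

text \<open>Lets the square of an increment of a power be replaced by an increment of squares, whose
  integral is explicit.\<close>

lemma diff_square_le_square_diff:
  fixes x y :: real
  assumes "0 \<le> y" "y \<le> x"
  shows "(x - y)\<^sup>2 \<le> x\<^sup>2 - y\<^sup>2"
proof -
  have "0 \<le> y * (x - y)" using assms by simp
  then show ?thesis by (simp add: power2_eq_square algebra_simps)
qed

section \<open>The Volterra kernel with unit constant and its derivative in time\<close>

definition volterra_integrand :: "real \<Rightarrow> real \<Rightarrow> real \<Rightarrow> real" where
  "volterra_integrand a u v = (v - u) powr (- a - 1) * (1 - (u / v) powr a)"

text \<open>With \<open>a = 1/2 - H\<close> the exponents \<open>H - 1/2\<close> and
  \<open>H - 3/2\<close> of the kernel become \<open>- a\<close> and \<open>- a - 1\<close>.\<close>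

definition vkernel :: "real \<Rightarrow> real \<Rightarrow> real \<Rightarrow> real" where
  "vkernel a t u =
     (if 0 < u \<and> u < t then (t - u) powr (- a) + a * (LINT v:{u..t}|lborel. volterra_integrand a u v) else 0)"

definition vdensity :: "real \<Rightarrow> real \<Rightarrow> real \<Rightarrow> real" where
  "vdensity a r u = - a * (u / r) powr a * (r - u) powr (- a - 1)"

locale kernel_exponent =
  fixes a :: real
  assumes a_pos: "0 < a" and a_less: "a < 1/4"
begin

lemma volterra_integrand_measurable [measurable]:
  "(\<lambda>v. volterra_integrand a u v) \<in> borel_measurable borel"
  unfolding volterra_integrand_def by measurable

lemma volterra_kernel_eq: "volterra_kernel c (1/2 - a) t u = c * vkernel a t u"
proof -
  have "(LINT v:{u..t}|lebesgue. (v - u) powr ((1/2 - a) - 3/2) * (1 - (u / v) powr (1/2 - (1/2 - a))))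
     = (LINT v:{u..t}|lborel. volterra_integrand a u v)"
    unfolding set_lebesgue_integral_def volterra_integrand_def
    by (subst integral_completion) (auto simp: minus_diff_commute)
  then show ?thesis
    by (simp add: volterra_kernel_def vkernel_def algebra_simps)
qed

text \<open>The factor \<open>1 - (u / v) powr a \<le> 1 - u / v\<close> vanishes to first order at
  \<open>v = u\<close>, which lowers the singularity from \<open>- a - 1\<close> to the integrable
  \<open>- a\<close>. The price \<open>1 / u\<close> is affordable while \<open>v\<close> stays
  comparable to \<open>u\<close>.\<close>

lemma volterra_integrand_bounds:
  assumes "0 < u" "u < v"
  shows "0 \<le> volterra_integrand a u v" and "volterra_integrand a u v \<le> (v - u) powr (- a) / u"
proof -
  have "(u / v) powr a \<le> 1"
    using assms a_pos by (intro powr_le1) auto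
  then show "0 \<le> volterra_integrand a u v"
    unfolding volterra_integrand_def by simp
  have "u / v = (u / v) powr 1" using assms by simp
  also have "\<dots> \<le> (u / v) powr a"
    using assms a_pos a_less by (intro powr_mono') auto
  finally have "1 - (u / v) powr a \<le> (v - u) / v"
    using assms by (simp add: field_simps)
  also have "\<dots> \<le> (v - u) / u"
    using assms by (intro divide_left_mono) auto
  finally have "volterra_integrand a u v \<le> (v - u) powr (- a - 1) * ((v - u) / u)"
    unfolding volterra_integrand_def by (intro mult_left_mono) auto
  also have "\<dots> = (v - u) powr (- a) / u"
    using assms powr_mult_base[of "v - u" "- a - 1"] by (simp add: mult.commute)
  finally show "volterra_integrand a u v \<le> (v - u) powr (- a) / u" .
qed

lemma set_integrable_volterra_integrand:
  assumes "0 < u"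
  shows "set_integrable lborel {u..t} (volterra_integrand a u)"
proof (cases "u \<le> t")
  case True
  have "set_integrable lborel {u..t} (\<lambda>v. (v - u) powr (- a) / u)"
    using set_integrable_powr_minus_left[OF order_refl True, of "- a"] a_less by simp
  then show ?thesis
  proof (rule set_integrable_bound)
    show "AE v in lborel. v \<in> {u..t} \<longrightarrow>
        norm (volterra_integrand a u v) \<le> norm ((v - u) powr (- a) / u)"
    proof (intro AE_I2 impI)
      fix v assume "v \<in> {u..t}"
      then show "norm (volterra_integrand a u v) \<le> norm ((v - u) powr (- a) / u)"
        using volterra_integrand_bounds[of u v] assms
        by (cases "v = u") (auto simp: volterra_integrand_def)
    qed
  qed (auto simp: set_borel_measurable_def)
qed (auto simp: set_integrable_def)

text \<open>Differentiating the integral term returns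
  \<open>a * (t - u) powr (- a - 1) * (1 - (u / t) powr a)\<close>; its first part cancels the
  derivative of \<open>(t - u) powr (- a)\<close>, and the rest is the density.\<close>

lemma vkernel_has_derivative:
  assumes "0 < u" "u < t"
  shows "((\<lambda>x. vkernel a x u) has_real_derivative vdensity a t u) (at t)"
proof -
  let ?w = "volterra_integrand a u"
  have wi: "?w integrable_on {u..x}" for x
    using set_borel_integral_eq_integral(1)[OF set_integrable_volterra_integrand[OF assms(1)]] .
  have eq: "vkernel a x u = (x - u) powr (- a) + a * integral {u..x} ?w" if "u < x" for x
    using that assms set_borel_integral_eq_integral(2)[OF set_integrable_volterra_integrand[OF assms(1), of x]]
    by (simp add: vkernel_def)
  have cont: "continuous (at t within {u..t + 1}) ?w"
    unfolding volterra_integrand_def using assms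
    by (intro continuous_intros) auto
  have "((\<lambda>x. integral {u..x} ?w) has_vector_derivative ?w t) (at t within {u..t + 1})"
    using integral_has_vector_derivative_continuous_at[of ?w u "t + 1" t "{}"] wi cont assms by auto
  then have "((\<lambda>x. integral {u..x} ?w) has_vector_derivative ?w t) (at t)"
    using at_within_interior[of t "{u..t+1}"] assms by (simp add: at_within_Icc_at)
  then have "((\<lambda>x. integral {u..x} ?w) has_real_derivative ?w t) (at t)"
    by (simp add: has_real_derivative_iff_has_vector_derivative)
  then have "((\<lambda>x. (x - u) powr (- a) + a * integral {u..x} ?w) has_real_derivative
       (- a * (t - u) powr (- a - 1) + a * ?w t)) (at t)"
    using assms by (auto intro!: derivative_eq_intros)
  also have "- a * (t - u) powr (- a - 1) + a * ?w t = vdensity a t u"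
    by (simp add: volterra_integrand_def vdensity_def algebra_simps)
  finally show ?thesis
    by (rule has_field_derivative_transform_within_open[where S="{u<..}"]) (use assms eq in auto)
qed

lemma vdensity_bounds:
  assumes "0 < u" "u < r"
  shows "vdensity a r u \<le> 0" "\<bar>vdensity a r u\<bar> \<le> a * (r - u) powr (- a - 1)"
proof -
  have "(u / r) powr a \<le> 1"
    using assms a_pos by (intro powr_le1) auto
  then have "a * ((u / r) powr a * (r - u) powr (- a - 1)) \<le> a * (1 * (r - u) powr (- a - 1))"
    using a_pos by (intro mult_left_mono mult_right_mono) auto
  then show "vdensity a r u \<le> 0" "\<bar>vdensity a r u\<bar> \<le> a * (r - u) powr (- a - 1)"
    using a_pos by (auto simp: vdensity_def abs_mult mult.assoc)
qed

lemma vdensity_measurable [measurable]: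
  assumes [measurable]: "f \<in> borel_measurable M" "g \<in> borel_measurable M"
  shows "(\<lambda>x. vdensity a (f x) (g x)) \<in> borel_measurable M"
  unfolding vdensity_def by measurable

text \<open>The density has constant sign, so the fundamental theorem already yields Lebesgue
  integrability, and the total mass over \<open>{t..t'}\<close> is the decrease of the kernel in
  time. The explicit bound comes from \<open>(u / r) powr a \<le> 1\<close>.\<close>

lemma
  assumes "0 < u" "u < t" "t \<le> t'"
  shows set_integrable_vdensity: "set_integrable lborel {t..t'} (\<lambda>r. vdensity a r u)"
    and LINT_vdensity: "(LINT r:{t..t'}|lborel. vdensity a r u) = vkernel a t' u - vkernel a t u"
    and LINT_abs_vdensity_le: "(LINT r:{t..t'}|lborel. \<bar>vdensity a r u\<bar>)
           \<le> (t - u) powr (- a) - (t' - u) powr (- a)"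
    and LINT_abs_vdensity: "(LINT r:{t..t'}|lborel. \<bar>vdensity a r u\<bar>) = vkernel a t u - vkernel a t' u"
proof -
  have "((\<lambda>r. vdensity a r u) has_integral vkernel a t' u - vkernel a t u) {t..t'}"
  proof (rule fundamental_theorem_of_calculus[OF assms(3)])
    show "((\<lambda>x. vkernel a x u) has_vector_derivative vdensity a r u) (at r within {t..t'})"
      if "r \<in> {t..t'}" for r
      using vkernel_has_derivative[of u r] that assms
      by (auto simp: has_real_derivative_iff_has_vector_derivative intro: has_vector_derivative_at_within)
  qed
  from has_integral_neg[OF this]
  have *: "((\<lambda>r. - vdensity a r u) has_integral - (vkernel a t' u - vkernel a t u)) {t..t'}" .
  note ** = set_integrable_lborel_of_nonneg_has_integral[OF *]
  have int: "set_integrable lborel {t..t'} (\<lambda>r. - vdensity a r u)"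
    and val: "(LINT r:{t..t'}|lborel. - vdensity a r u) = - (vkernel a t' u - vkernel a t u)"
    using vdensity_bounds(1)[of u] assms by (intro **; simp)+
  show int': "set_integrable lborel {t..t'} (\<lambda>r. vdensity a r u)"
    using int by (simp add: set_integrable_def)
  show "(LINT r:{t..t'}|lborel. vdensity a r u) = vkernel a t' u - vkernel a t u"
    using val by (simp add: set_lebesgue_integral_def)
  have abs: "(LINT r:{t..t'}|lborel. \<bar>vdensity a r u\<bar>) = (LINT r:{t..t'}|lborel. - vdensity a r u)"
    using assms vdensity_bounds(1)[of u] by (intro set_lebesgue_integral_cong) (auto simp: abs_of_nonpos)
  then show "(LINT r:{t..t'}|lborel. \<bar>vdensity a r u\<bar>) = vkernel a t u - vkernel a t' u"
    using val by simp
  have "(LINT r:{t..t'}|lborel. - vdensity a r u) \<le> (LINT r:{t..t'}|lborel. a * (r - u) powr (- a - 1))"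
    using assms vdensity_bounds(2)[of u] a_pos
      set_integrable_powr_minus_off[OF assms(2,3), of "- a - 1"]
    by (intro set_integral_mono int set_integrable_mult_right) (auto simp: abs_le_iff)
  also have "\<dots> = (t - u) powr (- a) - (t' - u) powr (- a)"
    using a_pos by (simp add: LINT_powr_minus_off[OF assms(2,3)] algebra_simps)
  finally show "(LINT r:{t..t'}|lborel. \<bar>vdensity a r u\<bar>) \<le> (t - u) powr (- a) - (t' - u) powr (- a)"
    using abs by simp
qed

lemma vkernel_antimono:
  assumes "0 < u" "u < t" "t \<le> t'"
  shows "vkernel a t' u \<le> vkernel a t u"
proof -
  have "0 \<le> (LINT r:{t..t'}|lborel. \<bar>vdensity a r u\<bar>)"
    unfolding set_lebesgue_integral_def by (intro integral_nonneg_AE) auto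
  then show ?thesis using LINT_abs_vdensity[OF assms] by simp
qed

lemma vkernel_nonneg: "0 \<le> vkernel a t u"
proof (cases "0 < u \<and> u < t")
  case True
  have "0 \<le> (LINT v:{u..t}|lborel. volterra_integrand a u v)"
    unfolding set_lebesgue_integral_def
  proof (intro integral_nonneg_AE AE_I2)
    fix v
    show "0 \<le> indicator {u..t} v *\<^sub>R volterra_integrand a u v"
      using volterra_integrand_bounds(1)[of u v] True
      by (cases "v = u") (auto simp: indicator_def volterra_integrand_def)
  qed
  then show ?thesis using True a_pos by (auto simp: vkernel_def)
qed (auto simp: vkernel_def)

text \<open>Up to time \<open>2 * u\<close> the integrand is at most
  \<open>(v - u) powr (- a) / u\<close>. Later on the kernel, which decreases in time, is bounded by
  its value at \<open>2 * u\<close>, and that is at most \<open>2 * u powr (- a)\<close>.\<close>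

lemma vkernel_le:
  assumes "0 < u" "u < t"
  shows "vkernel a t u \<le> (t - u) powr (- a) + 3 * u powr (- a)"
proof -
  have near: "vkernel a x u \<le> (x - u) powr (- a) + u powr (- a)" if "u < x" "x \<le> 2 * u" for x
  proof -
    have "(LINT v:{u..x}|lborel. volterra_integrand a u v) \<le> (LINT v:{u..x}|lborel. (v - u) powr (- a) / u)"
    proof (intro set_integral_mono set_integrable_volterra_integrand assms(1))
      show "set_integrable lborel {u..x} (\<lambda>v. (v - u) powr (- a) / u)"
        using set_integrable_powr_minus_left[of u u x "- a"] that a_less by simp
      show "volterra_integrand a u v \<le> (v - u) powr (- a) / u" if "v \<in> {u..x}" for v
        using that volterra_integrand_bounds[of u v] assms
        by (cases "v = u") (auto simp: volterra_integrand_def)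
    qed
    also have "\<dots> = (x - u) powr (1 - a) / (1 - a) / u"
      using LINT_powr_minus_left[of u u x "- a"] that a_less by simp
    also have "\<dots> \<le> u powr (1 - a) / (1 - a) / u"
      using that assms a_less by (intro divide_right_mono powr_mono2) auto
    also have "\<dots> = u powr (- a) / (1 - a)"
      using assms by (simp add: powr_diff powr_minus divide_simps)
    finally have "a * (LINT v:{u..x}|lborel. volterra_integrand a u v) \<le> a * (u powr (- a) / (1 - a))"
      using a_pos by (intro mult_left_mono) auto
    also have "\<dots> = a / (1 - a) * u powr (- a)" by simp
    also have "\<dots> \<le> 1 * u powr (- a)"
      using a_pos a_less by (intro mult_right_mono) (auto simp: field_simps)
    finally show ?thesis using that assms by (simp add: vkernel_def)
  qed
  show ?thesis
  proof (cases "t \<le> 2 * u")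
    case True
    have "0 \<le> u powr (- a)" by simp
    with near[OF assms(2) True] show ?thesis by linarith
  next
    case False
    have "vkernel a t u \<le> vkernel a (2 * u) u"
      using False assms by (intro vkernel_antimono) auto
    also have "\<dots> \<le> 2 * u powr (- a)"
      using near[of "2 * u"] assms by simp
    also have "\<dots> \<le> (t - u) powr (- a) + 3 * u powr (- a)"
    proof -
      have "0 \<le> u powr (- a)" "0 \<le> (t - u) powr (- a)" by auto
      then show ?thesis by linarith
    qed
    finally show ?thesis .
  qed
qed

lemma vkernel_measurable [measurable]: "(\<lambda>u. vkernel a t u) \<in> borel_measurable borel"
proof -
  have "(\<lambda>u. LINT v|lborel. indicator {u..t} v * volterra_integrand a u v) \<in> borel_measurable borel"
    unfolding volterra_integrand_def indicator_def atLeastAtMost_iff by measurable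
  note [measurable] = this
  show ?thesis
    unfolding vkernel_def set_lebesgue_integral_def real_scaleR_def by measurable
qed

end


section \<open>Square integral bounds for the adjoint operator\<close>

text \<open>The operator \<open>K\<^sup>*\<close> for the kernel with unit constant, set to
  \<open>0\<close> for \<open>u \<le> 0\<close> so that pairings can run over the whole
  line.\<close>

definition vstar :: "real \<Rightarrow> (real \<Rightarrow> real) \<Rightarrow> real \<Rightarrow> real \<Rightarrow> real" where
  "vstar a f t u =
     (if 0 < u \<and> u < t
      then f u * vkernel a t u + (LINT r:{u..t}|lborel. (f r - f u) * vdensity a r u) else 0)"

text \<open>
  Oscillation of a function that is Hoelder continuous of exponent \<open>1/4\<close> up to jumps of size \<open>\<theta>\<close>, the
  first jump after \<open>u\<close> being at distance at least \<open>d u\<close>. The exponent \<open>1/4\<close> is the only one that lies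
  between \<open>a = 1/2 - H\<close> and \<open>H\<close> for all \<open>H > 1/4\<close>: above \<open>a\<close> the increments tame the singularity of the
  density, below \<open>H\<close> the constant \<open>B\<close> of an interpolation error tends to \<open>0\<close>.
\<close>

definition oscillation_le :: "real \<Rightarrow> real \<Rightarrow> (real \<Rightarrow> real) \<Rightarrow> (real \<Rightarrow> real) \<Rightarrow> bool" where
  "oscillation_le B \<theta> d f \<longleftrightarrow> 0 < B \<and> f \<in> borel_measurable borel \<and>
     (\<forall>u\<in>{0<..<1}. \<bar>f u\<bar> \<le> B \<and>
        (\<forall>r\<in>{u..<1}. \<bar>f r - f u\<bar> \<le> B * ((r - u) powr (1/4) + (if u + d u \<le> r then \<theta> else 0))))"

text \<open>A jump \<open>\<theta>\<close> at distance \<open>d u\<close> contributes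
  \<open>\<theta> * d u powr (- a)\<close> at \<open>u\<close>. Bounding its mean square over
  \<open>{t..t'}\<close> by \<open>A\<close> makes the jumps no worse than the remaining terms,
  whose square integral is of order \<open>(t' - t) powr (1 - 2 * a)\<close>.\<close>

definition jumps_le :: "real \<Rightarrow> real \<Rightarrow> (real \<Rightarrow> real) \<Rightarrow> real \<Rightarrow> real \<Rightarrow> real \<Rightarrow> bool" where
  "jumps_le a \<theta> d A t t' \<longleftrightarrow> 0 \<le> \<theta> \<and> 0 \<le> A \<and> (\<forall>u. 0 < d u) \<and>
     set_integrable lborel {t..t'} (\<lambda>u. d u powr (- 2 * a)) \<and>
     \<theta>\<^sup>2 * (LINT u:{t..t'}|lborel. d u powr (- 2 * a)) \<le> A * (t' - t)"

text \<open>Majorant of the squared increment of \<open>vstar\<close> from \<open>t\<close> to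
  \<open>t'\<close> when \<open>B = 1\<close>. On \<open>{t..t'}\<close> the factor \<open>4\<close>
  comes from squaring a sum of four terms, \<open>9\<close> is the square of the \<open>3\<close> in
  \<open>vkernel_le\<close>, and \<open>a / (1/4 - a)\<close> bounds the contribution of the Hoelder
  part.\<close>

definition star_envelope :: "real \<Rightarrow> real \<Rightarrow> (real \<Rightarrow> real) \<Rightarrow> real \<Rightarrow> real \<Rightarrow> real \<Rightarrow> real" where
  "star_envelope a \<theta> d t t' u =
     indicator {0..t} u * ((t - u) powr (- 2 * a) - (t' - u) powr (- 2 * a)) +
     indicator {t..t'} u * (4 * ((t' - u) powr (- 2 * a) + 9 * u powr (- 2 * a)
        + (a / (1/4 - a))\<^sup>2 + \<theta>\<^sup>2 * d u powr (- 2 * a)))"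

text \<open>The integrated envelope, term by term; \<open>10 = 1 + 9\<close> collects the powers of
  \<open>t' - u\<close> and of \<open>u\<close>.\<close>

definition star_const :: "real \<Rightarrow> real \<Rightarrow> real" where
  "star_const a A = 1 / (1 - 2 * a) + 4 * (10 / (1 - 2 * a) + (a / (1/4 - a))\<^sup>2 + A)"

text \<open>Stands for the integral of \<open>f\<close> over \<open>[0,t]\<close> against the path
  \<open>K g\<close>; for \<open>f = 1\<close> it is this path.\<close>

definition star_pairing :: "real \<Rightarrow> (real \<Rightarrow> real) \<Rightarrow> (real \<Rightarrow> real) \<Rightarrow> real \<Rightarrow> real" where
  "star_pairing a g f t = (LINT u|lebesgue. vstar a f t u * g u)"

lemma abs_set_integral_le:
  fixes f :: "'a \<Rightarrow> real"
  shows "\<bar>LINT r:S|M. f r\<bar> \<le> (LINT r|M. norm (indicator S r *\<^sub>R f r))"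
  unfolding set_lebesgue_integral_def real_norm_def[symmetric] by (rule integral_norm_bound)

section \<open>Pointwise estimates for the adjoint operator\<close>

context kernel_exponent
begin

lemma vstar_measurable [measurable]:
  assumes [measurable]: "f \<in> borel_measurable borel"
  shows "(\<lambda>u. vstar a f t u) \<in> borel_measurable borel"
proof -
  have "(\<lambda>u. LINT r|lborel. indicator {u..t} r * ((f r - f u) * vdensity a r u)) \<in> borel_measurable borel"
    unfolding indicator_def atLeastAtMost_iff by measurable
  note [measurable] = this
  show ?thesis
    unfolding vstar_def set_lebesgue_integral_def real_scaleR_def by measurable
qed

text \<open>The Hoelder part turns the density into \<open>(r - u) powr (- (3/4) - a)\<close>,
  integrable because \<open>a < 1/4\<close>. The jump part starts only at \<open>u + d u\<close> and
  integrates to at most \<open>\<theta> * d u powr (- a)\<close>.\<close>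

lemma
  assumes f: "oscillation_le B \<theta> d f" and u: "0 < u" "u < t" "t \<le> 1" and \<theta>: "0 \<le> \<theta>" and d: "0 < d u"
  shows set_integrable_increment_vdensity:
      "set_integrable lborel {u..t} (\<lambda>r. (f r - f u) * vdensity a r u)"
    and increment_vdensity_le: "\<bar>LINT r:{u..t}|lborel. (f r - f u) * vdensity a r u\<bar>
           \<le> B * (a / (1/4 - a) + \<theta> * d u powr (- a))"
proof -
  have [measurable]: "f \<in> borel_measurable borel" and B: "0 < B"
    using f by (auto simp: oscillation_le_def)
  define w where "w r = B * a * (indicator {u..t} r * (r - u) powr (- (3/4) - a))
      + B * \<theta> * a * (indicator {u + d u..t} r * (r - u) powr (- a - 1))" for r
  have i1: "integrable lborel (\<lambda>r. indicator {u..t} r * (r - u) powr (- (3/4) - a))"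
    using set_integrable_powr_minus_left[of u u t "- (3/4) - a"] u a_less
    by (simp add: set_integrable_def)
  have v1: "(LINT r|lborel. indicator {u..t} r * (r - u) powr (- (3/4) - a)) \<le> 1 / (1/4 - a)"
  proof -
    have "(LINT r|lborel. indicator {u..t} r * (r - u) powr (- (3/4) - a))
        = (t - u) powr (1/4 - a) / (1/4 - a)"
      using LINT_powr_minus_left[of u u t "- (3/4) - a"] u a_less
      by (simp add: set_lebesgue_integral_def)
    also have "\<dots> \<le> 1 / (1/4 - a)"
      using u a_less by (intro divide_right_mono powr_le1) auto
    finally show ?thesis .
  qed
  have i2: "integrable lborel (\<lambda>r. indicator {u + d u..t} r * (r - u) powr (- a - 1))"
  proof (cases "u + d u \<le> t")
    case True
    then show ?thesis
      using set_integrable_powr_minus_off[of u "u + d u" t "- a - 1"] d a_pos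
      by (simp add: set_integrable_def)
  qed auto
  have v2: "a * (LINT r|lborel. indicator {u + d u..t} r * (r - u) powr (- a - 1)) \<le> d u powr (- a)"
  proof (cases "u + d u \<le> t")
    case True
    then have "a * (LINT r|lborel. indicator {u + d u..t} r * (r - u) powr (- a - 1))
        = d u powr (- a) - (t - u) powr (- a)"
      using LINT_powr_minus_off[of u "u + d u" t "- a - 1"] d a_pos
      by (simp add: set_lebesgue_integral_def right_diff_distrib)
    then show ?thesis by simp
  qed auto
  have wi: "integrable lborel w"
    unfolding w_def by (intro Bochner_Integration.integrable_add integrable_mult_right i1 i2)
  \<comment> \<open>The point \<open>r = 1\<close> is dropped because \<open>oscillation_le\<close>
    is silent there: a dyadic step function at \<open>1\<close> takes its value from a cell beyond
    \<open>[0,1]\<close>.\<close>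
  have bound: "AE r in lborel. norm (indicator {u..t} r *\<^sub>R ((f r - f u) * vdensity a r u)) \<le> w r"
    using AE_lborel_singleton[of 1]
  proof eventually_elim
    case (elim r)
    consider "r < u \<or> t < r" | "r = u" | "u < r" "r \<le> t" by linarith
    then show ?case
    proof cases
      case 1
      then show ?thesis using d a_pos \<theta> B by (auto simp: w_def indicator_def)
    next
      case 2
      then show ?thesis using a_pos \<theta> B by (auto simp: w_def)
    next
      case 3
      then have r: "r < 1" "u < 1" using elim u by auto
      have "\<bar>f r - f u\<bar> \<le> B * ((r - u) powr (1/4) + (if u + d u \<le> r then \<theta> else 0))"
        using f u r 3 by (auto simp: oscillation_le_def)
      then have "\<bar>f r - f u\<bar> * \<bar>vdensity a r u\<bar>
         \<le> B * ((r - u) powr (1/4) + (if u + d u \<le> r then \<theta> else 0)) * (a * (r - u) powr (- a - 1))"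
        using vdensity_bounds(2)[of u r] u 3 B \<theta> a_pos by (intro mult_mono) auto
      also have "\<dots> = B * a * ((r - u) powr (1/4) * (r - u) powr (- a - 1))
          + B * (if u + d u \<le> r then \<theta> else 0) * a * (r - u) powr (- a - 1)"
        by (simp add: algebra_simps)
      also have "\<dots> = w r"
        using 3 by (simp add: w_def powr_add[symmetric])
      finally show ?thesis using 3 by (simp add: abs_mult)
    qed
  qed
  show int: "set_integrable lborel {u..t} (\<lambda>r. (f r - f u) * vdensity a r u)"
    unfolding set_integrable_def
  proof (rule Bochner_Integration.integrable_bound[OF wi])
    show "AE r in lborel. norm (indicator {u..t} r *\<^sub>R ((f r - f u) * vdensity a r u)) \<le> norm (w r)"
      using bound by eventually_elim auto
  qed simp
  have "\<bar>LINT r:{u..t}|lborel. (f r - f u) * vdensity a r u\<bar>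
      \<le> (LINT r|lborel. norm (indicator {u..t} r *\<^sub>R ((f r - f u) * vdensity a r u)))"
    by (rule abs_set_integral_le)
  also have "\<dots> \<le> (LINT r|lborel. w r)"
    using int wi bound unfolding set_integrable_def by (intro integral_mono_AE integrable_norm)
  also have "\<dots> = B * a * (LINT r|lborel. indicator {u..t} r * (r - u) powr (- (3/4) - a))
      + B * \<theta> * (a * (LINT r|lborel. indicator {u + d u..t} r * (r - u) powr (- a - 1)))"
    unfolding w_def using i1 i2 by (subst Bochner_Integration.integral_add) auto
  also have "\<dots> \<le> B * a * (1 / (1/4 - a)) + B * \<theta> * d u powr (- a)"
    using B a_pos \<theta> by (intro add_mono mult_left_mono v1 v2) auto
  finally show "\<bar>LINT r:{u..t}|lborel. (f r - f u) * vdensity a r u\<bar>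
           \<le> B * (a / (1/4 - a) + \<theta> * d u powr (- a))"
    by (simp add: algebra_simps)
qed

lemma vstar_abs_le:
  assumes f: "oscillation_le B \<theta> d f" and u: "0 < u" "u < t" "t \<le> 1" and \<theta>: "0 \<le> \<theta>" and d: "0 < d u"
  shows "\<bar>vstar a f t u\<bar> \<le> B * ((t - u) powr (- a) + 3 * u powr (- a) + a / (1/4 - a) + \<theta> * d u powr (- a))"
proof -
  have "\<bar>f u\<bar> \<le> B" "0 < B" using f u by (auto simp: oscillation_le_def)
  then have "\<bar>f u * vkernel a t u\<bar> \<le> B * ((t - u) powr (- a) + 3 * u powr (- a))"
    unfolding abs_mult using vkernel_le[of u t] vkernel_nonneg[of t u] u
    by (intro mult_mono) auto
  then show ?thesis
    using increment_vdensity_le[OF f u \<theta> d] u by (simp add: vstar_def algebra_simps)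
qed

text \<open>The kernel increment times \<open>f u\<close> is the integral of \<open>f u\<close>
  times the density, so the subtracted value \<open>f u\<close> cancels. Over
  \<open>{t..t'}\<close>, away from the singularity, the increment is controlled by
  \<open>\<bar>f\<bar> \<le> B\<close> and the mass of the density.\<close>

lemma
  assumes f: "oscillation_le B \<theta> d f" and u: "0 < u" "u < t" "t \<le> t'" "t' \<le> 1" and \<theta>: "0 \<le> \<theta>" and d: "0 < d u"
  shows vstar_diff: "vstar a f t' u - vstar a f t u = (LINT r:{t..t'}|lborel. f r * vdensity a r u)"
    and vstar_diff_abs_le: "\<bar>vstar a f t' u - vstar a f t u\<bar> \<le> B * ((t - u) powr (- a) - (t' - u) powr (- a))"
proof -
  have [measurable]: "f \<in> borel_measurable borel" and B: "0 < B"
    using f by (auto simp: oscillation_le_def)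
  let ?G = "\<lambda>r. (f r - f u) * vdensity a r u"
  have int': "set_integrable lborel {u..t'} ?G"
    using u by (intro set_integrable_increment_vdensity[OF f _ _ _ \<theta> d]) auto
  have int: "set_integrable lborel {x..y} ?G" if "u \<le> x" "y \<le> t'" for x y
    using that by (intro set_integrable_subset[OF int']) auto
  have "integral {u..t} ?G + integral {t..t'} ?G = integral {u..t'} ?G"
    using u set_borel_integral_eq_integral(1)[OF int'] by (intro Henstock_Kurzweil_Integration.integral_combine) auto
  then have split: "(LINT r:{u..t'}|lborel. ?G r)
      = (LINT r:{u..t}|lborel. ?G r) + (LINT r:{t..t'}|lborel. ?G r)"
    using u by (simp add: set_borel_integral_eq_integral(2)[OF int])
  have kint: "set_integrable lborel {t..t'} (\<lambda>r. f u * vdensity a r u)"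
    using set_integrable_vdensity[OF u(1-3)] by simp
  have "(LINT r:{t..t'}|lborel. ?G r + f u * vdensity a r u)
      = (LINT r:{t..t'}|lborel. ?G r) + (LINT r:{t..t'}|lborel. f u * vdensity a r u)"
    using u by (intro set_integral_add int kint) auto
  also have "(LINT r:{t..t'}|lborel. f u * vdensity a r u) = f u * (vkernel a t' u - vkernel a t u)"
    using LINT_vdensity[OF u(1-3)] by simp
  finally have "(LINT r:{t..t'}|lborel. f r * vdensity a r u)
      = (LINT r:{t..t'}|lborel. ?G r) + f u * (vkernel a t' u - vkernel a t u)"
    by (simp add: algebra_simps)
  then show eq: "vstar a f t' u - vstar a f t u = (LINT r:{t..t'}|lborel. f r * vdensity a r u)"
    using u split by (simp add: vstar_def algebra_simps)
  have fint: "set_integrable lborel {t..t'} (\<lambda>r. f r * vdensity a r u)"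
    using set_integral_add(1)[OF int kint] u by (simp add: algebra_simps)
  have kint': "set_integrable lborel {t..t'} (\<lambda>r. B * \<bar>vdensity a r u\<bar>)"
    using set_integrable_abs[OF set_integrable_vdensity[OF u(1-3)]] by simp
  have "\<bar>LINT r:{t..t'}|lborel. f r * vdensity a r u\<bar>
      \<le> (LINT r|lborel. norm (indicator {t..t'} r *\<^sub>R (f r * vdensity a r u)))"
    by (rule abs_set_integral_le)
  also have "\<dots> \<le> (LINT r:{t..t'}|lborel. B * \<bar>vdensity a r u\<bar>)"
    unfolding set_lebesgue_integral_def
  proof (rule integral_mono_AE)
    show "AE r in lborel. norm (indicator {t..t'} r *\<^sub>R (f r * vdensity a r u))
        \<le> indicator {t..t'} r *\<^sub>R (B * \<bar>vdensity a r u\<bar>)"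
      using AE_lborel_singleton[of 1]
    proof eventually_elim
      case (elim r)
      have "\<bar>f r\<bar> \<le> B" if "r \<in> {t..t'}"
        using f that elim u by (auto simp: oscillation_le_def)
      then show ?case by (auto simp: indicator_def abs_mult intro!: mult_right_mono)
    qed
  qed (use fint kint' in \<open>auto simp: set_integrable_def\<close>)
  also have "\<dots> = B * (LINT r:{t..t'}|lborel. \<bar>vdensity a r u\<bar>)" by simp
  also have "\<dots> \<le> B * ((t - u) powr (- a) - (t' - u) powr (- a))"
    using LINT_abs_vdensity_le[OF u(1-3)] B by (intro mult_left_mono) auto
  finally show "\<bar>vstar a f t' u - vstar a f t u\<bar> \<le> B * ((t - u) powr (- a) - (t' - u) powr (- a))"
    unfolding eq .
qed

lemma square_powr: "(x powr (- a))\<^sup>2 = x powr (- 2 * a)"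
  by (simp add: power2_eq_square powr_add[symmetric])

lemma vstar_diff_square_le:
  assumes f: "oscillation_le B \<theta> d f" and t: "0 \<le> t" "t \<le> t'" "t' \<le> 1" and u: "u \<noteq> 0" "u \<noteq> t" "u \<noteq> t'"
    and \<theta>: "0 \<le> \<theta>" and d: "0 < d u"
  shows "(vstar a f t' u - vstar a f t u)\<^sup>2 \<le> B\<^sup>2 * star_envelope a \<theta> d t t' u"
proof -
  have B: "0 < B" using f by (auto simp: oscillation_le_def)
  consider "u < 0 \<or> t' < u" | "0 < u" "u < t" | "t < u" "0 < u" "u < t'" using u by linarith
  then show ?thesis
  proof cases
    case 1
    then show ?thesis using t by (auto simp: vstar_def star_envelope_def)
  next
    case 2
    have "(vstar a f t' u - vstar a f t u)\<^sup>2 \<le> (B * ((t - u) powr (- a) - (t' - u) powr (- a)))\<^sup>2"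
      using vstar_diff_abs_le[OF f 2 t(2,3) \<theta> d] by (rule abs_le_square_iff[THEN iffD1, OF order_trans]) auto
    also have "\<dots> = B\<^sup>2 * ((t - u) powr (- a) - (t' - u) powr (- a))\<^sup>2"
      by (simp add: power_mult_distrib)
    also have "\<dots> \<le> B\<^sup>2 * (((t - u) powr (- a))\<^sup>2 - ((t' - u) powr (- a))\<^sup>2)"
      using 2 t a_pos by (intro mult_left_mono diff_square_le_square_diff powr_mono2') auto
    also have "\<dots> = B\<^sup>2 * star_envelope a \<theta> d t t' u"
      using 2 t unfolding square_powr by (simp add: star_envelope_def)
    finally show ?thesis .
  next
    case 3
    define p q r s where "p = (t' - u) powr (- a)" and "q = 3 * u powr (- a)"
      and "r = a / (1/4 - a)" and "s = \<theta> * d u powr (- a)"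
    \<comment> \<open>Between \<open>t\<close> and \<open>t'\<close> nothing cancels: the full size
      of \<open>vstar\<close> enters, but only over a short interval.\<close>
    have "vstar a f t u = 0" using 3 by (simp add: vstar_def)
    then have "\<bar>vstar a f t' u - vstar a f t u\<bar> \<le> \<bar>B * (p + q + r + s)\<bar>"
      using vstar_abs_le[of B \<theta> d f u t', OF f _ _ _ \<theta> d] 3 t unfolding p_def q_def r_def s_def by simp
    then have "(vstar a f t' u - vstar a f t u)\<^sup>2 \<le> (B * (p + q + r + s))\<^sup>2"
      by (rule abs_le_square_iff[THEN iffD1])
    also have "\<dots> = B\<^sup>2 * (p + q + r + s)\<^sup>2" by (simp add: power_mult_distrib)
    also have "\<dots> \<le> B\<^sup>2 * (4 * (p\<^sup>2 + q\<^sup>2 + r\<^sup>2 + s\<^sup>2))"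
    proof (intro mult_left_mono)
      have "0 \<le> (p-q)\<^sup>2 + (p-r)\<^sup>2 + (p-s)\<^sup>2 + (q-r)\<^sup>2 + (q-s)\<^sup>2 + (r-s)\<^sup>2" by simp
      then show "(p + q + r + s)\<^sup>2 \<le> 4 * (p\<^sup>2 + q\<^sup>2 + r\<^sup>2 + s\<^sup>2)"
        by (simp add: power2_eq_square algebra_simps)
    qed simp
    also have "4 * (p\<^sup>2 + q\<^sup>2 + r\<^sup>2 + s\<^sup>2) = star_envelope a \<theta> d t t' u"
      using 3 unfolding p_def q_def r_def s_def power_mult_distrib square_powr
      by (simp add: star_envelope_def)
    finally show ?thesis .
  qed
qed

text \<open>Every piece is at most a multiple of \<open>(t' - t) powr (1 - 2 * a)\<close>:
  differences of powers by \<open>powr_diff_le\<close>, the constant and the jumps because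
  \<open>t' - t \<le> 1\<close>. The integrals of \<open>e1\<close> and \<open>e2\<close> are close
  to each other without being small.\<close>

lemma
  assumes t: "0 \<le> t" "t \<le> t'" "t' \<le> 1" and j: "jumps_le a \<theta> d A t t'"
  shows integrable_star_envelope: "integrable lborel (star_envelope a \<theta> d t t')"
    and integral_star_envelope_le:
      "(LINT u|lborel. star_envelope a \<theta> d t t' u) \<le> star_const a A * (t' - t) powr (1 - 2 * a)"
proof -
  let ?p = "1 - 2 * a"
  have p: "0 < ?p" "?p \<le> 1" "-1 < - 2 * a" using a_pos a_less by auto
  let ?\<delta> = "(t' - t) powr ?p"
  define e1 e2 e3 e4 e5 :: "real \<Rightarrow> real"
    where "e1 u = indicator {0..t} u * (t - u) powr (- 2 * a)"
      and "e2 u = indicator {0..t} u * (t' - u) powr (- 2 * a)"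
      and "e3 u = indicator {t..t'} u * (t' - u) powr (- 2 * a)"
      and "e4 u = indicator {t..t'} u * u powr (- 2 * a)"
      and "e5 u = indicator {t..t'} u * d u powr (- 2 * a)" for u
  note e_defs = e1_def[abs_def] e2_def[abs_def] e3_def[abs_def] e4_def[abs_def] e5_def[abs_def]
  let ?c = "\<lambda>u. indicator {t..t'} u * (a / (1/4 - a))\<^sup>2"
  have env: "star_envelope a \<theta> d t t' u
      = (e1 u - e2 u) + 4 * (e3 u + 9 * e4 u + ?c u + \<theta>\<^sup>2 * e5 u)" for u
    by (simp add: star_envelope_def e_defs algebra_simps)
  have i: "integrable lborel e1" "integrable lborel e2" "integrable lborel e3" "integrable lborel e4"
      "integrable lborel e5" "integrable lborel ?c"
    using set_integrable_powr_minus_right[of 0 t t "- 2 * a"] set_integrable_powr_minus_right[of 0 t t' "- 2 * a"]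
      set_integrable_powr_minus_right[of t t' t' "- 2 * a"] set_integrable_powr_minus_left[of 0 t t' "- 2 * a"] j t p
    by (auto simp: set_integrable_def e_defs jumps_le_def)
  have v: "integral\<^sup>L lborel e1 = t powr ?p / ?p" "integral\<^sup>L lborel e2 = t' powr ?p / ?p - ?\<delta> / ?p"
      "integral\<^sup>L lborel e3 = ?\<delta> / ?p" "integral\<^sup>L lborel e4 = t' powr ?p / ?p - t powr ?p / ?p"
      "integral\<^sup>L lborel ?c = (a / (1/4 - a))\<^sup>2 * (t' - t)"
    using LINT_powr_minus_right[of 0 t t "- 2 * a"] LINT_powr_minus_right[of 0 t t' "- 2 * a"]
      LINT_powr_minus_right[of t t' t' "- 2 * a"] LINT_powr_minus_left[of 0 t t' "- 2 * a"] t p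
    by (simp_all add: set_lebesgue_integral_def e_defs algebra_simps)
  have v5: "\<theta>\<^sup>2 * integral\<^sup>L lborel e5 \<le> A * (t' - t)" and A: "0 \<le> A"
    using j by (auto simp: jumps_le_def set_lebesgue_integral_def e_defs)
  show "integrable lborel (star_envelope a \<theta> d t t')"
    unfolding env using i by auto
  have \<delta>: "t' - t \<le> ?\<delta>"
    using powr_mono'[of ?p 1 "t' - t"] t p by simp
  have sub: "t' powr ?p - t powr ?p \<le> ?\<delta>" using powr_diff_le[of t t' ?p] t p by auto
  have mono: "t powr ?p \<le> t' powr ?p" using t p by (intro powr_mono2) auto
  have "(LINT u|lborel. star_envelope a \<theta> d t t' u) =
      (integral\<^sup>L lborel e1 - integral\<^sup>L lborel e2) + 4 * (integral\<^sup>L lborel e3 + 9 * integral\<^sup>L lborel e4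
         + integral\<^sup>L lborel ?c + \<theta>\<^sup>2 * integral\<^sup>L lborel e5)"
    unfolding env using i by simp
  also have "\<dots> \<le> ?\<delta> / ?p + 4 * (?\<delta> / ?p + 9 * (?\<delta> / ?p) + (a / (1/4 - a))\<^sup>2 * ?\<delta> + A * ?\<delta>)"
  proof -
    have "integral\<^sup>L lborel e1 - integral\<^sup>L lborel e2 \<le> ?\<delta> / ?p"
      unfolding v using mono p by (simp add: divide_simps)
    moreover have "integral\<^sup>L lborel e4 \<le> ?\<delta> / ?p"
      unfolding v using sub p by (simp add: divide_simps)
    moreover have "integral\<^sup>L lborel ?c \<le> (a / (1/4 - a))\<^sup>2 * ?\<delta>"
      unfolding v using \<delta> by (intro mult_left_mono) auto
    moreover have "\<theta>\<^sup>2 * integral\<^sup>L lborel e5 \<le> A * ?\<delta>"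
      using v5 mult_left_mono[OF \<delta> A] by linarith
    ultimately show ?thesis using v(3) by (intro add_mono mult_left_mono) auto
  qed
  also have "\<dots> = star_const a A * ?\<delta>"
    by (simp add: star_const_def algebra_simps)
  finally show "(LINT u|lborel. star_envelope a \<theta> d t t' u) \<le> star_const a A * ?\<delta>" .
qed

section \<open>Pairings with a square integrable function\<close>

lemma vstar_at_0 [simp]: "vstar a f 0 u = 0"
  by (simp add: vstar_def)

lemma star_pairing_at_0 [simp]: "star_pairing a g f 0 = 0"
  by (simp add: star_pairing_def)

lemma AE_lebesgue_neq: "AE u in lebesgue. u \<noteq> (x::real)"
  using AE_lborel_singleton[of x] by (rule AE_completion)

lemma abs_mult_le_weighted: "\<bar>x * y\<bar> \<le> (x\<^sup>2 / l + l * y\<^sup>2) / 2" if "0 < l" for x y l :: real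
proof -
  have "0 \<le> (\<bar>x\<bar> - l * \<bar>y\<bar>)\<^sup>2" by simp
  then have "2 * l * (\<bar>x\<bar> * \<bar>y\<bar>) \<le> x\<^sup>2 + l\<^sup>2 * y\<^sup>2"
    by (simp add: power2_diff power_mult_distrib algebra_simps)
  then show ?thesis using that by (simp add: field_simps abs_mult power2_eq_square)
qed

lemma
  assumes f: "oscillation_le B \<theta> d f" and t: "0 \<le> t" "t < t'" "t' \<le> 1" and j: "jumps_le a \<theta> d A t t'"
    and g [measurable]: "g \<in> borel_measurable lebesgue" and g2: "integrable lebesgue (\<lambda>u. (g u)\<^sup>2)"
  shows integrable_vstar_diff: "integrable lebesgue (\<lambda>u. (vstar a f t' u - vstar a f t u) * g u)"
    and integral_vstar_diff_le: "\<bar>LINT u|lebesgue. (vstar a f t' u - vstar a f t u) * g u\<bar>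
          \<le> B * ((star_const a A + (LINT u|lebesgue. (g u)\<^sup>2)) / 2) * (t' - t) powr (1/2 - a)"
proof -
  have [measurable]: "f \<in> borel_measurable borel" and B: "0 < B"
    using f by (auto simp: oscillation_le_def)
  have [measurable]: "(\<lambda>u. vstar a f t u) \<in> borel_measurable lebesgue" for t
    by (rule measurable_completion) simp
  define D where "D u = vstar a f t' u - vstar a f t u" for u
  let ?E = "star_envelope a \<theta> d t t'"
  have Ei: "integrable lebesgue ?E"
    using integrable_star_envelope[OF t(1) _ t(3) j] t by (subst integrable_completion) (auto intro: borel_measurable_integrable)
  have Ev: "(LINT u|lebesgue. ?E u) \<le> star_const a A * (t' - t) powr (1 - 2 * a)"
    using integral_star_envelope_le[OF t(1) _ t(3) j] integrable_star_envelope[OF t(1) _ t(3) j] t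
    by (subst integral_completion) (auto intro: borel_measurable_integrable)
  \<comment> \<open>The weight that balances the two terms of Young's inequality, which replaces Cauchy-Schwarz.\<close>
  define l where "l = B * (t' - t) powr (1/2 - a)"
  have l: "0 < l" using B t by (simp add: l_def)
  define w where "w u = (B\<^sup>2 / l * ?E u + l * (g u)\<^sup>2) / 2" for u
  have wi: "integrable lebesgue w"
    unfolding w_def using Ei g2 by (intro integrable_divide Bochner_Integration.integrable_add integrable_mult_right)
  have bound: "AE u in lebesgue. norm (D u * g u) \<le> w u"
    using AE_lebesgue_neq[of 0] AE_lebesgue_neq[of t] AE_lebesgue_neq[of t']
  proof eventually_elim
    case (elim u)
    have "(D u)\<^sup>2 \<le> B\<^sup>2 * ?E u"
      unfolding D_def using j t elim
      by (intro vstar_diff_square_le[OF f]) (auto simp: jumps_le_def)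
    then have "((D u)\<^sup>2 / l + l * (g u)\<^sup>2) / 2 \<le> w u"
      using l by (simp add: w_def divide_right_mono)
    then show ?case using abs_mult_le_weighted[OF l, of "D u" "g u"] by simp
  qed
  have int: "integrable lebesgue (\<lambda>u. D u * g u)"
  proof (rule Bochner_Integration.integrable_bound[OF wi])
    show "AE u in lebesgue. norm (D u * g u) \<le> norm (w u)"
      using bound by eventually_elim auto
  qed (simp add: D_def)
  then show "integrable lebesgue (\<lambda>u. (vstar a f t' u - vstar a f t u) * g u)"
    by (simp add: D_def)
  have "\<bar>LINT u|lebesgue. D u * g u\<bar> \<le> (LINT u|lebesgue. norm (D u * g u))"
    by (metis integral_norm_bound real_norm_def)
  also have "\<dots> \<le> (LINT u|lebesgue. w u)"
    using int wi bound by (intro integral_mono_AE integrable_norm)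
  also have "\<dots> = (B\<^sup>2 / l * (LINT u|lebesgue. ?E u) + l * (LINT u|lebesgue. (g u)\<^sup>2)) / 2"
    unfolding w_def using Ei g2 by simp
  also have "\<dots> \<le> (B\<^sup>2 / l * (star_const a A * (t' - t) powr (1 - 2 * a)) + l * (LINT u|lebesgue. (g u)\<^sup>2)) / 2"
    using l Ev by (intro divide_right_mono add_right_mono mult_left_mono) auto
  also have "B\<^sup>2 / l * (star_const a A * (t' - t) powr (1 - 2 * a)) = l * star_const a A"
  proof -
    have "(t' - t) powr (1 - 2 * a) = (t' - t) powr (1/2 - a) * (t' - t) powr (1/2 - a)"
      by (simp add: powr_add[symmetric])
    then have "B\<^sup>2 * (t' - t) powr (1 - 2 * a) = l * l"
      by (simp add: l_def power2_eq_square)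
    then have "B\<^sup>2 / l * (t' - t) powr (1 - 2 * a) = l"
      using l by (simp add: field_simps)
    then have "(B\<^sup>2 / l * (t' - t) powr (1 - 2 * a)) * star_const a A = l * star_const a A" by (rule arg_cong)
    then show ?thesis by (simp only: ac_simps)
  qed
  finally show "\<bar>LINT u|lebesgue. (vstar a f t' u - vstar a f t u) * g u\<bar>
          \<le> B * ((star_const a A + (LINT u|lebesgue. (g u)\<^sup>2)) / 2) * (t' - t) powr (1/2 - a)"
    by (simp add: D_def l_def algebra_simps)
qed

lemma integrable_vstar:
  assumes f: "oscillation_le B \<theta> d f" and t: "0 \<le> t" "t \<le> 1" and j: "jumps_le a \<theta> d A 0 t"
    and g: "g \<in> borel_measurable lebesgue" "integrable lebesgue (\<lambda>u. (g u)\<^sup>2)"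
  shows "integrable lebesgue (\<lambda>u. vstar a f t u * g u)"
  using integrable_vstar_diff[OF f _ _ t(2) j g] t by (cases "t = 0") auto

lemma star_pairing_diff_le:
  assumes f: "oscillation_le B \<theta> d f" and t: "0 \<le> t" "t \<le> t'" "t' \<le> 1"
    and j: "jumps_le a \<theta> d A t t'" "jumps_le a \<theta> d A 0 t" "jumps_le a \<theta> d A 0 t'"
    and g: "g \<in> borel_measurable lebesgue" "integrable lebesgue (\<lambda>u. (g u)\<^sup>2)"
  shows "\<bar>star_pairing a g f t' - star_pairing a g f t\<bar>
          \<le> B * ((star_const a A + (LINT u|lebesgue. (g u)\<^sup>2)) / 2) * (t' - t) powr (1/2 - a)"
proof (cases "t = t'")
  case False
  have "star_pairing a g f t' - star_pairing a g f t
      = (LINT u|lebesgue. (vstar a f t' u - vstar a f t u) * g u)"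
    unfolding star_pairing_def left_diff_distrib
    using t by (intro Bochner_Integration.integral_diff[symmetric] integrable_vstar[OF f _ _ _ g, where A=A] j) auto
  then show ?thesis
    using integral_vstar_diff_le[OF f t(1) _ t(3) j(1) g] False t by simp
qed simp

end


section \<open>Step functions on dyadic cells\<close>

lemma floor_dyadic_cell:
  fixes r :: real
  assumes "real l / 2 ^ m \<le> r" "r < real (Suc l) / 2 ^ m"
  shows "\<lfloor>r * 2 ^ m\<rfloor> = int l"
  using assms by (intro floor_unique) (auto simp: field_simps)

lemma dyadic_le_1:
  assumes "n \<le> 2 ^ m"
  shows "real n / 2 ^ m \<le> 1"
proof -
  have "real n \<le> real (2 ^ m)" using assms by (simp only: of_nat_le_iff)
  then show ?thesis by simp
qed

text \<open>Distance to the first grid point strictly to the right of \<open>u\<close>; the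
  \<open>+ 1\<close> makes it a full mesh, not \<open>0\<close>, when \<open>u\<close> itself lies
  on the grid.\<close>

definition dyadic_gap :: "nat \<Rightarrow> real \<Rightarrow> real" where
  "dyadic_gap m u = (\<lfloor>u * 2 ^ m\<rfloor> + 1) / 2 ^ m - u"

lemma dyadic_gap_pos: "0 < dyadic_gap m u"
proof -
  have "u * 2 ^ m < \<lfloor>u * 2 ^ m\<rfloor> + 1" by linarith
  then show ?thesis by (simp add: dyadic_gap_def field_simps)
qed

lemma dyadic_gap_measurable [measurable]: "dyadic_gap m \<in> borel_measurable borel"
  unfolding dyadic_gap_def by measurable

lemma floor_eq_of_less_gap:
  assumes "u \<le> r" "r < u + dyadic_gap m u"
  shows "\<lfloor>r * 2 ^ m\<rfloor> = \<lfloor>u * 2 ^ m\<rfloor>"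
proof (rule floor_unique)
  have "u * 2 ^ m \<le> r * 2 ^ m" using assms by simp
  then show "real_of_int \<lfloor>u * 2 ^ m\<rfloor> \<le> r * 2 ^ m" by linarith
  show "r * 2 ^ m < real_of_int \<lfloor>u * 2 ^ m\<rfloor> + 1"
    using assms(2) by (simp add: dyadic_gap_def field_simps)
qed

lemma dyadic_gap_le: "dyadic_gap m u \<le> 1 / 2 ^ m"
proof -
  have "\<lfloor>u * 2 ^ m\<rfloor> \<le> u * 2 ^ m" by linarith
  then show ?thesis by (simp add: dyadic_gap_def field_simps)
qed

text \<open>In the interior of a cell the index is frozen, and the endpoints do not affect the
  integral.\<close>

lemma has_integral_floor_cells:
  fixes F :: "int \<Rightarrow> real \<Rightarrow> real"
  assumes cell: "\<And>l. p \<le> l \<Longrightarrow> l < q \<Longrightarrow> (F (int l) has_integral J l) {real l / 2 ^ m..real (Suc l) / 2 ^ m}"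
    and "p \<le> q"
  shows "((\<lambda>r. F \<lfloor>r * 2 ^ m\<rfloor> r) has_integral (\<Sum>l = p..<q. J l)) {real p / 2 ^ m..real q / 2 ^ m}"
  using \<open>p \<le> q\<close> cell
proof (induction q rule: dec_induct)
  case base
  then show ?case by (simp add: has_integral_refl)
next
  case (step n)
  have "((\<lambda>r. F \<lfloor>r * 2 ^ m\<rfloor> r) has_integral J n) (cbox (real n / 2 ^ m) (real (Suc n) / 2 ^ m))"
  proof (rule has_integral_spike_interior)
    show "(F (int n) has_integral J n) (cbox (real n / 2 ^ m) (real (Suc n) / 2 ^ m))"
      using step by (simp add: cbox_interval)
    show "F \<lfloor>r * 2 ^ m\<rfloor> r = F (int n) r"
      if "r \<in> box (real n / 2 ^ m) (real (Suc n) / 2 ^ m)" for r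
      using floor_dyadic_cell[of n m r] that by simp
  qed
  then have "((\<lambda>r. F \<lfloor>r * 2 ^ m\<rfloor> r) has_integral J n) {real n / 2 ^ m..real (Suc n) / 2 ^ m}"
    by (simp add: cbox_interval)
  moreover have "((\<lambda>r. F \<lfloor>r * 2 ^ m\<rfloor> r) has_integral (\<Sum>l = p..<n. J l)) {real p / 2 ^ m..real n / 2 ^ m}"
    using step by auto
  ultimately have "((\<lambda>r. F \<lfloor>r * 2 ^ m\<rfloor> r) has_integral (\<Sum>l = p..<n. J l) + J n)
      {real p / 2 ^ m..real (Suc n) / 2 ^ m}"
    using step by (intro has_integral_combine[of "real p / 2 ^ m" "real n / 2 ^ m"]) (auto simp: divide_right_mono)
  then show ?case using step by simp
qed

context kernel_exponent
begin

lemma jumps_le_none: "t \<le> t' \<Longrightarrow> 0 \<le> A \<Longrightarrow> jumps_le a 0 (\<lambda>_. 1) A t t'"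
  by (simp add: jumps_le_def set_integrable_def)

text \<open>Each cell contributes \<open>\<delta> powr (1 - 2 * a) / (1 - 2 * a)\<close>, so the
  mean of \<open>dyadic_gap m u powr (- 2 * a)\<close> is of order
  \<open>\<delta> powr (- 2 * a)\<close>. The factor
  \<open>\<theta>\<^sup>2 = \<delta> powr (1/2)\<close> absorbs it because
  \<open>2 * a < 1/2\<close>.\<close>

lemma jumps_le_dyadic:
  assumes "p \<le> q"
  shows "jumps_le a ((1 / 2 ^ m) powr (1/4)) (dyadic_gap m) (1 / (1 - 2 * a)) (real p / 2 ^ m) (real q / 2 ^ m)"
proof -
  define \<delta> :: real where "\<delta> = 1 / 2 ^ m"
  have \<delta>: "0 < \<delta>" "\<delta> \<le> 1" by (auto simp: \<delta>_def)
  let ?p = "1 - 2 * a"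
  let ?F = "\<lambda>l u. ((real_of_int l + 1) / 2 ^ m - u) powr (- 2 * a)"
  have "(?F (int l) has_integral \<delta> powr ?p / ?p) {real l / 2 ^ m..real (Suc l) / 2 ^ m}" for l
  proof -
    have le: "real l / 2 ^ m \<le> real (Suc l) / 2 ^ m" by (simp add: divide_right_mono)
    have i: "set_integrable lborel {real l / 2 ^ m..real (Suc l) / 2 ^ m}
        (\<lambda>u. (real (Suc l) / 2 ^ m - u) powr (- 2 * a))"
      using a_less by (intro set_integrable_powr_minus_right le order_refl) auto
    have "((\<lambda>u. (real (Suc l) / 2 ^ m - u) powr (- 2 * a)) has_integral
        (real (Suc l) / 2 ^ m - real l / 2 ^ m) powr ?p / ?p) {real l / 2 ^ m..real (Suc l) / 2 ^ m}"
      using set_borel_integral_eq_integral[OF i]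
        LINT_powr_minus_right[OF le order_refl, of "- 2 * a"] a_less
      by (simp add: has_integral_iff algebra_simps)
    moreover have "real (Suc l) / 2 ^ m - real l / 2 ^ m = \<delta>"
      by (simp add: \<delta>_def field_simps)
    ultimately show ?thesis by (simp add: add.commute)
  qed
  from has_integral_floor_cells[where F="?F" and p=p and q=q and m=m, OF this assms]
  have *: "((\<lambda>u. dyadic_gap m u powr (- 2 * a)) has_integral (real (q - p) * (\<delta> powr ?p / ?p)))
       {real p / 2 ^ m..real q / 2 ^ m}"
    by (simp add: dyadic_gap_def)
  note ** = set_integrable_lborel_of_nonneg_has_integral[OF *]
  have "\<delta> powr (1/2) * \<delta> powr ?p \<le> \<delta> powr 1"
    unfolding powr_add[symmetric] using \<delta> a_less by (intro powr_mono') auto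
  then have le: "\<delta> powr (1/2) * \<delta> powr ?p \<le> \<delta>" using \<delta> by simp
  have "(\<delta> powr (1/4))\<^sup>2 * (real (q - p) * (\<delta> powr ?p / ?p)) = real (q - p) / ?p * (\<delta> powr (1/2) * \<delta> powr ?p)"
    by (simp add: power2_eq_square powr_add[symmetric])
  also have "\<dots> \<le> real (q - p) / ?p * \<delta>"
    using a_less by (intro mult_left_mono le) auto
  also have "\<dots> = 1 / ?p * (real q / 2 ^ m - real p / 2 ^ m)"
    using assms by (simp add: \<delta>_def of_nat_diff diff_divide_distrib mult.commute)
  finally have "(\<delta> powr (1/4))\<^sup>2 * (real (q - p) * (\<delta> powr ?p / ?p)) \<le> 1 / ?p * (real q / 2 ^ m - real p / 2 ^ m)" .
  then show ?thesis
    unfolding jumps_le_def using ** a_less dyadic_gap_pos by (simp add: \<delta>_def)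
qed

section \<open>The adjoint operator on step functions\<close>

lemma oscillation_le_const: "oscillation_le 1 0 (\<lambda>_. 1) (\<lambda>_. 1)"
  by (auto simp: oscillation_le_def)

lemma vstar_const: "vstar a (\<lambda>_. 1) t u = vkernel a t u"
  by (simp add: vstar_def vkernel_def)

lemma vstar_minus:
  assumes "oscillation_le B \<theta> d f" "oscillation_le B' \<theta>' d' f'" "0 \<le> \<theta>" "0 \<le> \<theta>'" "0 < d u" "0 < d' u" "t \<le> 1"
  shows "vstar a (\<lambda>r. f r - f' r) t u = vstar a f t u - vstar a f' t u"
proof (cases "0 < u \<and> u < t")
  case True
  then have "(LINT r:{u..t}|lborel. (f r - f u) * vdensity a r u - (f' r - f' u) * vdensity a r u)
     = (LINT r:{u..t}|lborel. (f r - f u) * vdensity a r u) - (LINT r:{u..t}|lborel. (f' r - f' u) * vdensity a r u)"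
    using assms by (intro set_integral_diff set_integrable_increment_vdensity[OF assms(1)]
      set_integrable_increment_vdensity[OF assms(2)]) auto
  moreover have "(\<lambda>r. (f r - f u) * vdensity a r u - (f' r - f' u) * vdensity a r u)
      = (\<lambda>r. (f r - f' r - (f u - f' u)) * vdensity a r u)"
    by (auto simp: algebra_simps)
  ultimately show ?thesis using True by (simp add: vstar_def algebra_simps)
qed (auto simp: vstar_def)

text \<open>A crude bound that does not improve with the mesh. It only makes
  \<open>vstar_diff\<close> applicable to step functions; the quantitative estimate concerns the
  error \<open>f - \<sigma>\<close>.\<close>

lemma oscillation_le_step:
  assumes "0 < B" "\<And>l. 0 \<le> l \<Longrightarrow> l < 2 ^ m \<Longrightarrow> \<bar>c l\<bar> \<le> B"
  shows "oscillation_le (2 * B) 1 (dyadic_gap m) (\<lambda>r. c \<lfloor>r * 2 ^ m\<rfloor>)"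
proof -
  have c: "\<bar>c \<lfloor>r * 2 ^ m\<rfloor>\<bar> \<le> B" if "0 < r" "r < 1" for r :: real
  proof (rule assms(2))
    show "0 \<le> \<lfloor>r * 2 ^ m\<rfloor>" using that by simp
    have "r * 2 ^ m < real_of_int (2 ^ m)" using that by simp
    then show "\<lfloor>r * 2 ^ m\<rfloor> < 2 ^ m" by (simp add: floor_less_iff)
  qed
  have "\<bar>c \<lfloor>r * 2 ^ m\<rfloor> - c \<lfloor>u * 2 ^ m\<rfloor>\<bar> \<le> 2 * B * ((r - u) powr (1/4) + (if u + dyadic_gap m u \<le> r then 1 else 0))"
    if "0 < u" "u \<le> r" "r < 1" for u r
  proof (cases "u + dyadic_gap m u \<le> r")
    case True
    have "\<bar>c \<lfloor>r * 2 ^ m\<rfloor> - c \<lfloor>u * 2 ^ m\<rfloor>\<bar> \<le> B + B"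
      using c[of r] c[of u] that by (intro order_trans[OF abs_triangle_ineq4] add_mono) auto
    also have "\<dots> \<le> 2 * B * ((r - u) powr (1/4) + 1)"
      using assms(1) by (simp add: distrib_left)
    finally show ?thesis using True by simp
  next
    case False
    then show ?thesis using floor_eq_of_less_gap[of u r m] that assms(1) by simp
  qed
  moreover have "(\<lambda>r::real. c \<lfloor>r * 2 ^ m\<rfloor>) \<in> borel_measurable borel"
    by measurable
  moreover have "\<bar>c \<lfloor>r * 2 ^ m\<rfloor>\<bar> \<le> 2 * B" if "0 < r" "r < 1" for r :: real
    using c[OF that] assms(1) by linarith
  ultimately show ?thesis
    using assms(1) by (simp add: oscillation_le_def)
qed

text \<open>\<open>K\<^sup>*\<close> sends the indicator of a cell to the increment of the kernel
  over that cell. The induction adds one cell at a time and distinguishes whether \<open>u\<close>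
  lies before, inside or after it.\<close>

lemma vstar_step:
  assumes B: "0 < B" "\<And>l. 0 \<le> l \<Longrightarrow> l < 2 ^ m \<Longrightarrow> \<bar>c l\<bar> \<le> B" and N: "N \<le> 2 ^ m"
  shows "vstar a (\<lambda>r. c \<lfloor>r * 2 ^ m\<rfloor>) (real N / 2 ^ m) u
    = (\<Sum>l<N. c (int l) * (vkernel a (real (Suc l) / 2 ^ m) u - vkernel a (real l / 2 ^ m) u))"
  using N
proof (induction N)
  case 0
  then show ?case by simp
next
  case (Suc N)
  let ?\<sigma> = "\<lambda>r::real. c \<lfloor>r * 2 ^ m\<rfloor>"
  let ?t = "real N / 2 ^ m" and ?t' = "real (Suc N) / 2 ^ m"
  have t: "0 \<le> ?t" "?t < ?t'" "?t' \<le> 1"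
    using dyadic_le_1[OF Suc.prems] by (auto intro: divide_strict_right_mono)
  have cell: "?\<sigma> r = c (int N)" if "?t \<le> r" "r < ?t'" for r
    using floor_dyadic_cell[of N m r] that by simp
  note \<sigma> = oscillation_le_step[of B m c, OF B]
  have "vstar a ?\<sigma> ?t' u - vstar a ?\<sigma> ?t u = c (int N) * (vkernel a ?t' u - vkernel a ?t u)"
  proof -
    consider "u \<le> 0 \<or> ?t' \<le> u" | "0 < u" "u < ?t" | "0 < u" "?t \<le> u" "u < ?t'" by linarith
    then show ?thesis
    proof cases
      case 1
      then show ?thesis using t by (auto simp: vstar_def vkernel_def)
    next
      case 2
      have "vstar a ?\<sigma> ?t' u - vstar a ?\<sigma> ?t u = (LINT r:{?t..?t'}|lborel. ?\<sigma> r * vdensity a r u)"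
        using t dyadic_gap_pos by (intro vstar_diff[OF \<sigma> 2]) auto
      also have "\<dots> = (LINT r:{?t..?t'}|lborel. c (int N) * vdensity a r u)"
        unfolding set_lebesgue_integral_def
      proof (rule integral_cong_AE)
        show "AE r in lborel. indicator {?t..?t'} r *\<^sub>R (?\<sigma> r * vdensity a r u)
            = indicator {?t..?t'} r *\<^sub>R (c (int N) * vdensity a r u)"
          using AE_lborel_singleton[of ?t'] by eventually_elim (auto simp: indicator_def cell)
      qed measurable
      also have "\<dots> = c (int N) * (vkernel a ?t' u - vkernel a ?t u)"
        using LINT_vdensity[OF 2, of ?t'] t by simp
      finally show ?thesis .
    next
      case 3
      \<comment> \<open>Inside the last cell the step function has no increments, and the kernel at
        the earlier time \<open>?t \<le> u\<close> is \<open>0\<close>.\<close>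
      have "(LINT r:{u..?t'}|lborel. (?\<sigma> r - ?\<sigma> u) * vdensity a r u) = 0"
        unfolding set_lebesgue_integral_def
      proof (rule integral_eq_zero_AE)
        show "AE r in lborel. indicator {u..?t'} r *\<^sub>R ((?\<sigma> r - ?\<sigma> u) * vdensity a r u) = 0"
          using AE_lborel_singleton[of ?t']
        proof eventually_elim
          case (elim r)
          then show ?case using 3 cell[of r] cell[of u] by (auto simp: indicator_def)
        qed
      qed
      then show ?thesis using 3 cell[of u] by (simp add: vstar_def vkernel_def)
    qed
  qed
  moreover have "vstar a ?\<sigma> ?t u
      = (\<Sum>l<N. c (int l) * (vkernel a (real (Suc l) / 2 ^ m) u - vkernel a (real l / 2 ^ m) u))"
    using Suc by simp
  ultimately show ?case unfolding sum.lessThan_Suc by linarith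
qed

lemma integrable_vkernel:
  assumes g: "g \<in> borel_measurable lebesgue" "integrable lebesgue (\<lambda>u. (g u)\<^sup>2)" and t: "0 \<le> t" "t \<le> 1"
  shows "integrable lebesgue (\<lambda>u. vkernel a t u * g u)"
  using integrable_vstar[OF oscillation_le_const t jumps_le_none[OF t(1) order_refl] g]
  by (simp add: vstar_const)

text \<open>Paired with \<open>g\<close>, the kernel increments become increments of the path
  \<open>K g\<close>, so the pairing of a step function is its Riemann-Stieltjes sum.\<close>

lemma star_pairing_step:
  assumes g: "g \<in> borel_measurable lebesgue" "integrable lebesgue (\<lambda>u. (g u)\<^sup>2)"
    and B: "0 < B" "\<And>l. 0 \<le> l \<Longrightarrow> l < 2 ^ m \<Longrightarrow> \<bar>c l\<bar> \<le> B" and N: "N \<le> 2 ^ m"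
  shows "star_pairing a g (\<lambda>r. c \<lfloor>r * 2 ^ m\<rfloor>) (real N / 2 ^ m)
    = (\<Sum>l<N. c (int l) * (star_pairing a g (\<lambda>_. 1) (real (Suc l) / 2 ^ m) - star_pairing a g (\<lambda>_. 1) (real l / 2 ^ m)))"
proof -
  have int: "integrable lebesgue (\<lambda>u. vkernel a (real l / 2 ^ m) u * g u)" if "l \<le> N" for l
    using that N by (intro integrable_vkernel g dyadic_le_1) auto
  have int': "integrable lebesgue (\<lambda>u. vkernel a (real (Suc l) / 2 ^ m) u * g u)" if "l < N" for l
    using int[of "Suc l"] that by simp
  have "star_pairing a g (\<lambda>r. c \<lfloor>r * 2 ^ m\<rfloor>) (real N / 2 ^ m)
      = (LINT u|lebesgue. (\<Sum>l<N. c (int l) * (vkernel a (real (Suc l) / 2 ^ m) u * g u - vkernel a (real l / 2 ^ m) u * g u)))"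
    unfolding star_pairing_def
  proof (rule Bochner_Integration.integral_cong[OF refl])
    fix u
    have "vstar a (\<lambda>r. c \<lfloor>r * 2 ^ m\<rfloor>) (real N / 2 ^ m) u
        = (\<Sum>l<N. c (int l) * (vkernel a (real (Suc l) / 2 ^ m) u - vkernel a (real l / 2 ^ m) u))"
      by (rule vstar_step[OF B N])
    then show "vstar a (\<lambda>r. c \<lfloor>r * 2 ^ m\<rfloor>) (real N / 2 ^ m) u * g u
        = (\<Sum>l<N. c (int l) * (vkernel a (real (Suc l) / 2 ^ m) u * g u - vkernel a (real l / 2 ^ m) u * g u))"
      by (simp only: sum_distrib_right mult.assoc left_diff_distrib)
  qed
  also have "\<dots> = (\<Sum>l<N. LINT u|lebesgue. c (int l) * (vkernel a (real (Suc l) / 2 ^ m) u * g u - vkernel a (real l / 2 ^ m) u * g u))"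
    using int int' by (intro Bochner_Integration.integral_sum) auto
  also have "\<dots> = (\<Sum>l<N. c (int l) * (star_pairing a g (\<lambda>_. 1) (real (Suc l) / 2 ^ m) - star_pairing a g (\<lambda>_. 1) (real l / 2 ^ m)))"
    using int int' by (intro sum.cong) (auto simp: star_pairing_def vstar_const Bochner_Integration.integral_diff)
  finally show ?thesis .
qed

end


section \<open>Integrals against dyadic interpolations\<close>

definition holder_le :: "real \<Rightarrow> real \<Rightarrow> (real \<Rightarrow> real) \<Rightarrow> bool" where
  "holder_le a C f \<longleftrightarrow> 0 < C \<and> f \<in> borel_measurable borel \<and> (\<forall>r\<in>{0..1}. \<bar>f r\<bar> \<le> C) \<and>
     (\<forall>r\<in>{0..1}. \<forall>u\<in>{0..1}. \<bar>f r - f u\<bar> \<le> C * \<bar>r - u\<bar> powr (1/2 - a))"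

text \<open>The derivative of the dyadic interpolation of \<open>y\<close> off the grid. At
  \<open>r = 1\<close> it reads \<open>y\<close> beyond \<open>1\<close>, so that this point is
  repeatedly discarded as a null set.\<close>

definition dyadic_slope :: "nat \<Rightarrow> (real \<Rightarrow> real) \<Rightarrow> real \<Rightarrow> real" where
  "dyadic_slope m y r =
     2 ^ m * (y ((\<lfloor>r * 2 ^ m\<rfloor> + 1) / 2 ^ m) - y (\<lfloor>r * 2 ^ m\<rfloor> / 2 ^ m))"

definition dyadic_integral :: "nat \<Rightarrow> (real \<Rightarrow> real) \<Rightarrow> (real \<Rightarrow> real) \<Rightarrow> real \<Rightarrow> real" where
  "dyadic_integral m y f t = integral {0..t} (\<lambda>r. f r * dyadic_slope m y r)"

definition dyadic_mean :: "nat \<Rightarrow> (real \<Rightarrow> real) \<Rightarrow> int \<Rightarrow> real" where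
  "dyadic_mean m f l = 2 ^ m * integral {l / 2 ^ m..(l + 1) / 2 ^ m} f"

lemma holder_le_diff:
  assumes "holder_le a C f" "0 \<le> u" "u \<le> r" "r \<le> 1"
  shows "\<bar>f r - f u\<bar> \<le> C * (r - u) powr (1/2 - a)"
proof -
  have "\<bar>f r - f u\<bar> \<le> C * \<bar>r - u\<bar> powr (1/2 - a)"
    using assms unfolding holder_le_def by (meson atLeastAtMost_iff order_trans)
  then show ?thesis using assms(3) by simp
qed

lemma holder_le_set_integrable:
  assumes "holder_le a C f" "0 \<le> x" "y \<le> 1"
  shows "set_integrable lborel {x..y} f"
  unfolding set_integrable_def
proof (rule Bochner_Integration.integrable_bound)
  show "integrable lborel (\<lambda>r. C * indicator {x..y} r)"
    by (cases "x \<le> y") auto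
  show "AE r in lborel. norm (indicator {x..y} r *\<^sub>R f r) \<le> norm (C * indicator {x..y} r)"
    using assms by (auto simp: holder_le_def indicator_def intro!: AE_I2)
qed (use assms in \<open>auto simp: holder_le_def\<close>)

lemma holder_le_integrable_on:
  assumes "holder_le a C f" "0 \<le> x" "y \<le> 1"
  shows "f integrable_on {x..y}"
  using set_borel_integral_eq_integral(1)[OF holder_le_set_integrable[OF assms]] .

lemma dyadic_integral_cell:
  assumes f: "holder_le a C f" and "l < 2 ^ m"
  shows "((\<lambda>r. f r * (2 ^ m * (y ((real_of_int (int l) + 1) / 2 ^ m) - y (real_of_int (int l) / 2 ^ m))))
    has_integral dyadic_mean m f l * (y (real (Suc l) / 2 ^ m) - y (real l / 2 ^ m)))
       {real l / 2 ^ m..real (Suc l) / 2 ^ m}"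
proof -
  have "f integrable_on {real l / 2 ^ m..real (Suc l) / 2 ^ m}"
    using assms dyadic_le_1[of "Suc l" m] by (intro holder_le_integrable_on[OF f]) auto
  then have "(f has_integral integral {real l / 2 ^ m..real (Suc l) / 2 ^ m} f) {real l / 2 ^ m..real (Suc l) / 2 ^ m}"
    by (rule integrable_integral)
  from has_integral_mult_left[OF this, of "2 ^ m * (y (real (Suc l) / 2 ^ m) - y (real l / 2 ^ m))"]
  show ?thesis by (simp add: dyadic_mean_def add.commute mult.assoc mult.left_commute)
qed

lemma
  assumes f: "holder_le a C f" and N: "N \<le> 2 ^ m"
  shows has_integral_dyadic_slope: "((\<lambda>r. f r * dyadic_slope m y r) has_integral
      (\<Sum>l<N. dyadic_mean m f (int l) * (y (real (Suc l) / 2 ^ m) - y (real l / 2 ^ m)))) {0..real N / 2 ^ m}"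
proof -
  have "((\<lambda>r. f r * (2 ^ m * (y ((real_of_int \<lfloor>r * 2 ^ m\<rfloor> + 1) / 2 ^ m) - y (real_of_int \<lfloor>r * 2 ^ m\<rfloor> / 2 ^ m))))
    has_integral (\<Sum>l = 0..<N. dyadic_mean m f l * (y (real (Suc l) / 2 ^ m) - y (real l / 2 ^ m))))
     {real 0 / 2 ^ m..real N / 2 ^ m}"
    using N by (intro has_integral_floor_cells
       [where F="\<lambda>l r. f r * (2 ^ m * (y ((real_of_int l + 1) / 2 ^ m) - y (real_of_int l / 2 ^ m)))"]
       dyadic_integral_cell[OF f]) auto
  then show ?thesis
    by (simp add: dyadic_slope_def atLeast0LessThan)
qed

lemma integrable_on_dyadic_slope:
  assumes f: "holder_le a C f" and "0 \<le> x" "z \<le> 1"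
  shows "(\<lambda>r. f r * dyadic_slope m y r) integrable_on {x..z}"
proof -
  have "(\<lambda>r. f r * dyadic_slope m y r) integrable_on {0..1}"
    using has_integral_dyadic_slope[OF f, of "2 ^ m" m y] by (auto simp: integrable_on_def)
  then show ?thesis
    by (rule integrable_on_subinterval) (use assms in auto)
qed

lemma dyadic_integral_diff:
  assumes f: "holder_le a C f" and "0 \<le> x" "x \<le> z" "z \<le> 1"
  shows "dyadic_integral m y f z - dyadic_integral m y f x = integral {x..z} (\<lambda>r. f r * dyadic_slope m y r)"
proof -
  have "integral {0..x} (\<lambda>r. f r * dyadic_slope m y r) + integral {x..z} (\<lambda>r. f r * dyadic_slope m y r)
      = integral {0..z} (\<lambda>r. f r * dyadic_slope m y r)"
    using assms by (intro Henstock_Kurzweil_Integration.integral_combine integrable_on_dyadic_slope[OF f]) auto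
  then show ?thesis by (simp add: dyadic_integral_def)
qed

lemma floor_dyadic_bounds:
  fixes r :: real
  assumes "0 \<le> r" "r < 1"
  shows "0 \<le> \<lfloor>r * 2 ^ m\<rfloor>" "\<lfloor>r * 2 ^ m\<rfloor> < 2 ^ m"
    "\<lfloor>r * 2 ^ m\<rfloor> / 2 ^ m \<le> r" "r < (\<lfloor>r * 2 ^ m\<rfloor> + 1) / 2 ^ m" "(\<lfloor>r * 2 ^ m\<rfloor> + 1) / 2 ^ m \<le> (1::real)"
proof -
  show "0 \<le> \<lfloor>r * 2 ^ m\<rfloor>" using assms by simp
  have "r * 2 ^ m < real_of_int (2 ^ m)" using assms by simp
  then show l: "\<lfloor>r * 2 ^ m\<rfloor> < 2 ^ m" by (simp add: floor_less_iff)
  have "\<lfloor>r * 2 ^ m\<rfloor> \<le> r * 2 ^ m" by linarith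
  then show "\<lfloor>r * 2 ^ m\<rfloor> / 2 ^ m \<le> r" by (simp add: field_simps)
  have "r * 2 ^ m < \<lfloor>r * 2 ^ m\<rfloor> + 1" by linarith
  then show "r < (\<lfloor>r * 2 ^ m\<rfloor> + 1) / 2 ^ m" by (simp add: field_simps)
  from l have "\<lfloor>r * 2 ^ m\<rfloor> + 1 \<le> 2 ^ m" by simp
  then have "real_of_int (\<lfloor>r * 2 ^ m\<rfloor> + 1) \<le> real_of_int (2 ^ m)" by (simp only: of_int_le_iff)
  then show "(\<lfloor>r * 2 ^ m\<rfloor> + 1) / 2 ^ m \<le> (1::real)" by simp
qed

section \<open>Approximation of Hoelder functions by dyadic means\<close>

context kernel_exponent
begin

lemma holder_le_const: "holder_le a 1 (\<lambda>_. 1)"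
  by (simp add: holder_le_def)

text \<open>Since \<open>1/2 - a\<close> exceeds \<open>1/4\<close> and the distances are at most
  \<open>1\<close>, there is nothing to put into the jump term.\<close>

lemma oscillation_le_of_holder:
  assumes f: "holder_le a C f"
  shows "oscillation_le C 0 (\<lambda>_. 1) f"
proof -
  have "\<bar>f r - f u\<bar> \<le> C * (r - u) powr (1/4)" if "0 < u" "u \<le> r" "r < 1" for r u
  proof -
    have "\<bar>f r - f u\<bar> \<le> C * (r - u) powr (1/2 - a)"
      using that by (intro holder_le_diff[OF f]) auto
    also have "\<dots> \<le> C * (r - u) powr (1/4)"
      using f that a_less by (intro mult_left_mono powr_mono') (auto simp: holder_le_def)
    finally show ?thesis .
  qed
  then show ?thesis using f by (auto simp: oscillation_le_def holder_le_def)
qed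

lemma abs_dyadic_mean_diff_le:
  assumes f: "holder_le a C f" and r: "0 \<le> r" "r < 1"
  shows "\<bar>f r - dyadic_mean m f \<lfloor>r * 2 ^ m\<rfloor>\<bar> \<le> C * (1 / 2 ^ m) powr (1/2 - a)"
proof -
  let ?x = "\<lfloor>r * 2 ^ m\<rfloor> / 2 ^ m :: real" and ?z = "(\<lfloor>r * 2 ^ m\<rfloor> + 1) / 2 ^ m :: real"
  note b = floor_dyadic_bounds[OF r, of m]
  have x: "0 \<le> ?x" "?x \<le> ?z" using b(1,3,4) by auto
  have len: "?z - ?x = 1 / 2 ^ m" by (simp add: diff_divide_distrib[symmetric])
  have "(f has_integral integral {?x..?z} f) {?x..?z}"
    using holder_le_integrable_on[OF f x(1) b(5)] by (rule integrable_integral)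
  moreover have "((\<lambda>_. f r) has_integral f r * (1 / 2 ^ m)) {?x..?z}"
    using has_integral_const_real[of "f r" ?x ?z] x len by (simp add: mult.commute)
  ultimately have "((\<lambda>s. f s - f r) has_integral (integral {?x..?z} f - f r * (1 / 2 ^ m))) {?x..?z}"
    by (rule has_integral_diff)
  then have "norm (integral {?x..?z} f - f r * (1 / 2 ^ m))
      \<le> C * (1 / 2 ^ m) powr (1/2 - a) * measure lborel {?x..?z}"
  proof (rule has_integral_bound_real[rotated 2])
    show "0 \<le> C * (1 / 2 ^ m) powr (1/2 - a)" using f by (simp add: holder_le_def)
    show "finite {}" by simp
    fix s assume s: "s \<in> {?x..?z} - {}"
    then have "0 \<le> s" "s \<le> 1" using order_trans[OF x(1)] order_trans[OF _ b(5)] by auto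
    then have "s \<in> {0..1}" "r \<in> {0..1}" using r by auto
    then have "\<bar>f s - f r\<bar> \<le> C * \<bar>s - r\<bar> powr (1/2 - a)"
      using f by (auto simp only: holder_le_def)
    also have "\<dots> \<le> C * (1 / 2 ^ m) powr (1/2 - a)"
      using f s b len a_less by (intro mult_left_mono powr_mono2) (auto simp: holder_le_def)
    finally show "norm (f s - f r) \<le> C * (1 / 2 ^ m) powr (1/2 - a)" by simp
  qed
  also have "measure lborel {?x..?z} = 1 / 2 ^ m" using x len by simp
  finally have "2 ^ m * \<bar>integral {?x..?z} f - f r * (1 / 2 ^ m)\<bar> \<le> C * (1 / 2 ^ m) powr (1/2 - a)"
    by (simp add: field_simps)
  also have "2 ^ m * \<bar>integral {?x..?z} f - f r * (1 / 2 ^ m)\<bar>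
      = \<bar>2 ^ m * (integral {?x..?z} f - f r * (1 / 2 ^ m))\<bar>"
    by (simp add: abs_mult)
  also have "2 ^ m * (integral {?x..?z} f - f r * (1 / 2 ^ m)) = dyadic_mean m f \<lfloor>r * 2 ^ m\<rfloor> - f r"
    by (simp add: dyadic_mean_def algebra_simps)
  finally show ?thesis by (simp add: abs_minus_commute)
qed

text \<open>Within a cell the mean is constant, and the exponent \<open>1/2 - a\<close> of
  \<open>f\<close> has \<open>1/4 - a\<close> to spare over \<open>1/4\<close>, which over a
  distance of at most \<open>\<delta>\<close> yields the small factor. Across cells both values of
  the error are at most \<open>C * \<delta> powr (1/2 - a)\<close>, and \<open>\<delta> powr (1/2 -
  a) = \<delta> powr (1/4 - a) * \<delta> powr (1/4)\<close> splits into this factor and the jump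
  size.\<close>

lemma oscillation_le_dyadic_error:
  assumes f: "holder_le a C f"
  shows "oscillation_le (2 * C * (1 / 2 ^ m) powr (1/4 - a)) ((1 / 2 ^ m) powr (1/4)) (dyadic_gap m)
    (\<lambda>r. f r - dyadic_mean m f \<lfloor>r * 2 ^ m\<rfloor>)"
proof -
  define \<delta> :: real where "\<delta> = 1 / 2 ^ m"
  have \<delta>: "0 < \<delta>" "\<delta> \<le> 1" by (auto simp: \<delta>_def)
  have C: "0 < C" and [measurable]: "f \<in> borel_measurable borel" using f by (auto simp: holder_le_def)
  let ?\<psi> = "\<lambda>r. f r - dyadic_mean m f \<lfloor>r * 2 ^ m\<rfloor>"
  have \<psi>: "\<bar>?\<psi> r\<bar> \<le> C * \<delta> powr (1/2 - a)" if "0 \<le> r" "r < 1" for r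
    using abs_dyadic_mean_diff_le[OF f that, of m] by (simp add: \<delta>_def)
  have "(\<lambda>r::real. dyadic_mean m f \<lfloor>r * 2 ^ m\<rfloor>) \<in> borel_measurable borel" by measurable
  then have meas: "?\<psi> \<in> borel_measurable borel" by measurable
  have small: "\<bar>?\<psi> u\<bar> \<le> 2 * C * \<delta> powr (1/4 - a)" if "0 < u" "u < 1" for u
  proof -
    have "\<bar>?\<psi> u\<bar> \<le> C * \<delta> powr (1/2 - a)" using \<psi>[of u] that by simp
    also have "\<dots> \<le> C * \<delta> powr (1/4 - a)"
      using C \<delta> by (intro mult_left_mono powr_mono') auto
    also have "\<dots> \<le> 2 * C * \<delta> powr (1/4 - a)" using C by simp
    finally show ?thesis .
  qed
  have "\<bar>?\<psi> r - ?\<psi> u\<bar> \<le> 2 * C * \<delta> powr (1/4 - a) *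
      ((r - u) powr (1/4) + (if u + dyadic_gap m u \<le> r then \<delta> powr (1/4) else 0))"
    if "0 < u" "u \<le> r" "r < 1" for u r
  proof (cases "u + dyadic_gap m u \<le> r")
    case True
    have "\<bar>?\<psi> r - ?\<psi> u\<bar> \<le> C * \<delta> powr (1/2 - a) + C * \<delta> powr (1/2 - a)"
      using that by (intro order_trans[OF abs_triangle_ineq4] add_mono \<psi>) auto
    also have "\<dots> = 2 * C * \<delta> powr (1/4 - a) * \<delta> powr (1/4)"
      by (simp add: powr_add[symmetric] mult.assoc)
    also have "\<dots> \<le> 2 * C * \<delta> powr (1/4 - a) * ((r - u) powr (1/4) + \<delta> powr (1/4))"
      using C by (intro mult_left_mono) auto
    finally show ?thesis using True by simp
  next
    case False
    then have "r - u \<le> \<delta>" using dyadic_gap_le[of m u] by (simp add: \<delta>_def)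
    have "\<bar>?\<psi> r - ?\<psi> u\<bar> = \<bar>f r - f u\<bar>"
      using floor_eq_of_less_gap[of u r m] False that by simp
    also have "\<dots> \<le> C * (r - u) powr (1/2 - a)"
      using that by (intro holder_le_diff[OF f]) auto
    also have "(r - u) powr (1/2 - a) = (r - u) powr (1/4 - a) * (r - u) powr (1/4)"
      by (simp add: powr_add[symmetric])
    also have "C * \<dots> \<le> C * (\<delta> powr (1/4 - a) * (r - u) powr (1/4))"
      using C that a_less \<open>r - u \<le> \<delta>\<close> by (intro mult_left_mono mult_right_mono powr_mono2) auto
    also have "\<dots> \<le> 2 * C * \<delta> powr (1/4 - a) * (r - u) powr (1/4)"
      using C by simp
    finally show ?thesis using False by simp
  qed
  then show ?thesis
    using C \<delta> meas small unfolding oscillation_le_def \<delta>_def[symmetric] by simp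
qed

lemma abs_dyadic_mean_le:
  assumes f: "holder_le a C f" and l: "0 \<le> l" "l < 2 ^ m"
  shows "\<bar>dyadic_mean m f l\<bar> \<le> 2 * C"
proof -
  let ?r = "l / 2 ^ m :: real"
  have "real_of_int l < real_of_int (2 ^ m)" using l by (simp only: of_int_less_iff)
  then have r: "0 \<le> ?r" "?r < 1" using l by auto
  have "\<bar>f ?r - dyadic_mean m f l\<bar> \<le> C * (1 / 2 ^ m) powr (1/2 - a)"
    using abs_dyadic_mean_diff_le[OF f r, of m] by simp
  also have "\<dots> \<le> C * 1"
    using f a_less by (intro mult_left_mono powr_le1) (auto simp: holder_le_def)
  finally have "\<bar>f ?r - dyadic_mean m f l\<bar> \<le> C" by simp
  moreover have "\<bar>f ?r\<bar> \<le> C" using f r by (auto simp: holder_le_def)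
  ultimately show ?thesis by linarith
qed

end

section \<open>Hoelder bounds uniform in the mesh\<close>

locale square_integrable_pairing = kernel_exponent +
  fixes g :: "real \<Rightarrow> real"
  assumes g_meas: "g \<in> borel_measurable lebesgue" and g_square: "integrable lebesgue (\<lambda>u. (g u)\<^sup>2)"
begin

text \<open>\<open>1 / (1 - 2 * a)\<close> is the jump constant of \<open>jumps_le_dyadic\<close>.
  Functions without jumps satisfy it too, so one constant serves both \<open>f\<close> and
  \<open>f - \<sigma>\<close>.\<close>

definition pairing_const :: real where
  "pairing_const = (star_const a (1 / (1 - 2 * a)) + (LINT u|lebesgue. (g u)\<^sup>2)) / 2"

abbreviation path :: "real \<Rightarrow> real" where
  "path \<equiv> star_pairing a g (\<lambda>_. 1)"

lemma pairing_const_nonneg: "0 \<le> pairing_const"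
proof -
  have "0 \<le> (LINT u|lebesgue. (g u)\<^sup>2)" by simp
  moreover have "0 \<le> star_const a (1 / (1 - 2 * a))"
    using a_less by (auto simp: star_const_def intro!: add_nonneg_nonneg)
  ultimately show ?thesis by (simp add: pairing_const_def)
qed

text \<open>For \<open>f = 1\<close> this is the Hoelder continuity of \<open>path\<close> itself,
  from which the bound on its dyadic slopes follows.\<close>

lemma pairing_holder_diff_le:
  assumes f: "holder_le a C f" and t: "0 \<le> t" "t \<le> t'" "t' \<le> 1"
  shows "\<bar>star_pairing a g f t' - star_pairing a g f t\<bar> \<le> C * pairing_const * (t' - t) powr (1/2 - a)"
  unfolding pairing_const_def
  by (rule star_pairing_diff_le[OF oscillation_le_of_holder[OF f] t _ _ _ g_meas g_square];
      rule jumps_le_none) (use a_less t in auto)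

lemma pairing_error_diff_le:
  assumes f: "holder_le a C f" and n: "n \<le> n'" "n' \<le> 2 ^ m"
  defines "\<psi> \<equiv> \<lambda>r. f r - dyadic_mean m f \<lfloor>r * 2 ^ m\<rfloor>"
  shows "\<bar>star_pairing a g \<psi> (real n' / 2 ^ m) - star_pairing a g \<psi> (real n / 2 ^ m)\<bar>
    \<le> 2 * C * (1 / 2 ^ m) powr (1/4 - a) * pairing_const * (real n' / 2 ^ m - real n / 2 ^ m) powr (1/2 - a)"
  unfolding pairing_const_def
proof (rule star_pairing_diff_le[OF oscillation_le_dyadic_error[OF f, of m, folded \<psi>_def] _ _ _ _ _ _ g_meas g_square])
  show "jumps_le a ((1 / 2 ^ m) powr (1/4)) (dyadic_gap m) (1 / (1 - 2 * a)) 0 (real n / 2 ^ m)"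
    "jumps_le a ((1 / 2 ^ m) powr (1/4)) (dyadic_gap m) (1 / (1 - 2 * a)) 0 (real n' / 2 ^ m)"
    using jumps_le_dyadic[of 0 n m] jumps_le_dyadic[of 0 n' m] by simp_all
qed (use n dyadic_le_1 jumps_le_dyadic in \<open>auto simp: divide_right_mono\<close>)

text \<open>The slope is constant on each cell, so the integral sees only the cell means of
  \<open>f\<close> and is the Riemann-Stieltjes sum of the step function that these means
  define.\<close>

lemma dyadic_integral_eq:
  assumes f: "holder_le a C f" and N: "N \<le> 2 ^ m"
  shows "dyadic_integral m path f (real N / 2 ^ m)
    = star_pairing a g f (real N / 2 ^ m)
      - star_pairing a g (\<lambda>r. f r - dyadic_mean m f \<lfloor>r * 2 ^ m\<rfloor>) (real N / 2 ^ m)"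
proof -
  let ?t = "real N / 2 ^ m"
  let ?\<psi> = "\<lambda>r. f r - dyadic_mean m f \<lfloor>r * 2 ^ m\<rfloor>"
  have t: "0 \<le> ?t" "?t \<le> 1" using dyadic_le_1[OF N] by auto
  note of = oscillation_le_of_holder[OF f] and o\<psi> = oscillation_le_dyadic_error[OF f, of m]
  have C: "0 < 2 * C" using f by (auto simp: holder_le_def)
  have "dyadic_integral m path f ?t
      = (\<Sum>l<N. dyadic_mean m f (int l) * (path (real (Suc l) / 2 ^ m) - path (real l / 2 ^ m)))"
    unfolding dyadic_integral_def using has_integral_dyadic_slope[OF f N] by (rule integral_unique)
  also have "\<dots> = star_pairing a g (\<lambda>r. dyadic_mean m f \<lfloor>r * 2 ^ m\<rfloor>) ?t"
    using star_pairing_step[OF g_meas g_square C _ N, of "dyadic_mean m f"] abs_dyadic_mean_le[OF f] by simp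
  also have "\<dots> = (LINT u|lebesgue. vstar a f ?t u * g u - vstar a ?\<psi> ?t u * g u)"
  proof -
    have "vstar a (\<lambda>r. dyadic_mean m f \<lfloor>r * 2 ^ m\<rfloor>) ?t u = vstar a f ?t u - vstar a ?\<psi> ?t u" for u
      using vstar_minus[OF of o\<psi>, of u ?t] t dyadic_gap_pos by simp
    then show ?thesis by (simp add: star_pairing_def left_diff_distrib)
  qed
  also have "\<dots> = star_pairing a g f ?t - star_pairing a g ?\<psi> ?t"
    unfolding star_pairing_def
  proof (rule Bochner_Integration.integral_diff)
    show "integrable lebesgue (\<lambda>u. vstar a f ?t u * g u)"
      using integrable_vstar[OF of t jumps_le_none[OF t(1) order_refl] g_meas g_square] .
    show "integrable lebesgue (\<lambda>u. vstar a ?\<psi> ?t u * g u)"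
      using integrable_vstar[OF o\<psi> t _ g_meas g_square] jumps_le_dyadic[of 0 N m] by simp
  qed
  finally show ?thesis .
qed

lemma dyadic_integral_grid_diff_le:
  assumes f: "holder_le a C f" and n: "n \<le> n'" "n' \<le> 2 ^ m"
  shows "\<bar>dyadic_integral m path f (real n' / 2 ^ m) - dyadic_integral m path f (real n / 2 ^ m)\<bar>
     \<le> 3 * C * pairing_const * (real n' / 2 ^ m - real n / 2 ^ m) powr (1/2 - a)"
proof -
  let ?t = "real n / 2 ^ m" and ?t' = "real n' / 2 ^ m"
  let ?\<psi> = "\<lambda>r. f r - dyadic_mean m f \<lfloor>r * 2 ^ m\<rfloor>"
  let ?K = "C * pairing_const * (?t' - ?t) powr (1/2 - a)"
  have t: "0 \<le> ?t" "?t \<le> ?t'" "?t' \<le> 1" using n dyadic_le_1 by (auto simp: divide_right_mono)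
  have C: "0 < C" using f by (auto simp: holder_le_def)
  have "0 \<le> ?K" using C pairing_const_nonneg by simp
  have "\<bar>star_pairing a g ?\<psi> ?t' - star_pairing a g ?\<psi> ?t\<bar> \<le> (1 / 2 ^ m) powr (1/4 - a) * (2 * ?K)"
    using pairing_error_diff_le[OF f n] by (simp add: mult_ac)
  also have "\<dots> \<le> 1 * (2 * ?K)"
    using a_less \<open>0 \<le> ?K\<close> by (intro mult_right_mono powr_le1) auto
  finally have "\<bar>star_pairing a g ?\<psi> ?t' - star_pairing a g ?\<psi> ?t\<bar> \<le> 2 * ?K" by simp
  moreover have "\<bar>star_pairing a g f ?t' - star_pairing a g f ?t\<bar> \<le> ?K"
    using pairing_holder_diff_le[OF f t] by simp
  ultimately have "\<bar>dyadic_integral m path f ?t' - dyadic_integral m path f ?t\<bar> \<le> 3 * ?K"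
    using n by (simp only: dyadic_integral_eq[OF f n(2)] dyadic_integral_eq[OF f order_trans[OF n]])
  then show ?thesis by simp
qed

lemma abs_dyadic_slope_le:
  assumes "0 \<le> r" "r < 1"
  shows "\<bar>dyadic_slope m path r\<bar> \<le> 2 ^ m * (pairing_const * (1 / 2 ^ m) powr (1/2 - a))"
proof -
  note b = floor_dyadic_bounds[OF assms, of m]
  have "(\<lfloor>r * 2 ^ m\<rfloor> + 1) / 2 ^ m - \<lfloor>r * 2 ^ m\<rfloor> / 2 ^ m = (1 / 2 ^ m :: real)"
    by (simp add: diff_divide_distrib[symmetric])
  then have "\<bar>path ((\<lfloor>r * 2 ^ m\<rfloor> + 1) / 2 ^ m) - path (\<lfloor>r * 2 ^ m\<rfloor> / 2 ^ m)\<bar>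
      \<le> 1 * pairing_const * (1 / 2 ^ m) powr (1/2 - a)"
    using pairing_holder_diff_le[OF holder_le_const, of "\<lfloor>r * 2 ^ m\<rfloor> / 2 ^ m" "(\<lfloor>r * 2 ^ m\<rfloor> + 1) / 2 ^ m"] b by simp
  then show ?thesis by (simp add: dyadic_slope_def abs_mult)
qed

text \<open>The interpolated path has slope at most of order
  \<open>\<delta> powr (- (1/2) - a)\<close>, where \<open>\<delta>\<close> is the mesh. For
  \<open>t' - t \<le> \<delta>\<close> the inequality
  \<open>(t' - t) powr (1/2 + a) \<le> \<delta> powr (1/2 + a)\<close> trades this Lipschitz bound
  for the exponent \<open>1/2 - a\<close>.\<close>

lemma dyadic_integral_short_diff_le:
  assumes f: "holder_le a C f" and t: "0 \<le> t" "t \<le> t'" "t' \<le> 1" "t' - t \<le> 1 / 2 ^ m"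
  shows "\<bar>dyadic_integral m path f t' - dyadic_integral m path f t\<bar>
     \<le> C * pairing_const * (t' - t) powr (1/2 - a)"
proof (cases "t = t'")
  case False
  define \<delta> :: real where "\<delta> = 1 / 2 ^ m"
  have C: "0 < C" using f by (auto simp: holder_le_def)
  define L where "L = C * (2 ^ m * (pairing_const * \<delta> powr (1/2 - a)))"
  have L: "0 \<le> L" using C pairing_const_nonneg by (simp add: L_def)
  have "((\<lambda>r. f r * dyadic_slope m path r) has_integral integral {t..t'} (\<lambda>r. f r * dyadic_slope m path r)) (cbox t t')"
    using integrable_integral[OF integrable_on_dyadic_slope[OF f t(1,3), of m path]] by (simp add: cbox_interval)
  then have "norm (integral {t..t'} (\<lambda>r. f r * dyadic_slope m path r)) \<le> L * measure lborel (cbox t t')"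
  proof (rule has_integral_bound_spike_finite[OF L, rotated 1])
    show "finite {1::real}" by simp
    fix r assume "r \<in> cbox t t' - {1}"
    then have r: "0 \<le> r" "r < 1" using t by (auto simp: cbox_interval)
    have "\<bar>f r\<bar> * \<bar>dyadic_slope m path r\<bar> \<le> L"
      unfolding L_def using f r abs_dyadic_slope_le[OF r, of m] C
      by (intro mult_mono) (auto simp: holder_le_def \<delta>_def)
    then show "norm (f r * dyadic_slope m path r) \<le> L" by (simp add: abs_mult)
  qed
  also have "L * measure lborel (cbox t t') = L * (t' - t)" using t by (simp add: cbox_interval)
  also have "L * (t' - t) \<le> C * pairing_const * (t' - t) powr (1/2 - a)"
  proof -
    have "t' - t = (t' - t) powr (1/2 - a) * (t' - t) powr (1/2 + a)"
      using t False by (simp add: powr_add[symmetric])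
    also have "\<dots> \<le> (t' - t) powr (1/2 - a) * \<delta> powr (1/2 + a)"
      using t a_pos by (intro mult_left_mono powr_mono2) (auto simp: \<delta>_def)
    finally have "\<delta> powr (1/2 - a) * (t' - t) \<le> \<delta> powr (1/2 - a) * ((t' - t) powr (1/2 - a) * \<delta> powr (1/2 + a))"
      by (intro mult_left_mono) auto
    also have "\<dots> = (\<delta> powr (1/2 - a) * \<delta> powr (1/2 + a)) * (t' - t) powr (1/2 - a)"
      by (simp only: ac_simps)
    also have "\<delta> powr (1/2 - a) * \<delta> powr (1/2 + a) = \<delta>"
      by (simp add: powr_add[symmetric] \<delta>_def)
    finally have "2 ^ m * (\<delta> powr (1/2 - a) * (t' - t)) \<le> 2 ^ m * (\<delta> * (t' - t) powr (1/2 - a))"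
      by (intro mult_left_mono) auto
    then have "2 ^ m * (\<delta> powr (1/2 - a) * (t' - t)) \<le> (t' - t) powr (1/2 - a)"
      by (simp add: \<delta>_def)
    then have "C * pairing_const * (2 ^ m * (\<delta> powr (1/2 - a) * (t' - t))) \<le> C * pairing_const * (t' - t) powr (1/2 - a)"
      using C pairing_const_nonneg by (intro mult_left_mono) auto
    then show ?thesis by (simp add: L_def mult_ac)
  qed
  finally show ?thesis
    using dyadic_integral_diff[OF f t(1-3), of m path] by simp
qed simp

text \<open>Both ends are rounded inwards to the grid. The part between grid points accounts for
  \<open>3\<close>, namely one for \<open>f\<close> and two for the error, and the two end pieces,
  no longer than the mesh, for \<open>1\<close> each.\<close>

lemma dyadic_integral_diff_le:
  assumes f: "holder_le a C f" and t: "0 \<le> t" "t \<le> t'" "t' \<le> 1"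
  shows "\<bar>dyadic_integral m path f t' - dyadic_integral m path f t\<bar>
     \<le> 5 * C * pairing_const * (t' - t) powr (1/2 - a)"
proof (cases "t' - t \<le> 1 / 2 ^ m")
  case True
  have "0 \<le> C * pairing_const * (t' - t) powr (1/2 - a)"
    using f pairing_const_nonneg by (simp add: holder_le_def)
  then show ?thesis using dyadic_integral_short_diff_le[OF f t True] by linarith
next
  case False
  let ?I = "dyadic_integral m path f"
  define n n' where "n = nat \<lceil>t * 2 ^ m\<rceil>" and "n' = nat \<lfloor>t' * 2 ^ m\<rfloor>"
  let ?p = "real n / 2 ^ m" and ?q = "real n' / 2 ^ m"
  have n: "real n = \<lceil>t * 2 ^ m\<rceil>" "real n' = \<lfloor>t' * 2 ^ m\<rfloor>" using t by (auto simp: n_def n'_def)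
  have "t * 2 ^ m \<le> real n" "real n \<le> t * 2 ^ m + 1" "real n' \<le> t' * 2 ^ m" "t' * 2 ^ m \<le> real n' + 1"
    unfolding n by linarith+
  then have "t \<le> ?p" "?p \<le> (t * 2 ^ m + 1) / 2 ^ m" "?q \<le> t'" "t' \<le> (real n' + 1) / 2 ^ m"
    by (auto simp: le_divide_eq divide_le_eq divide_right_mono)
  then have p: "t \<le> ?p" "?p - t \<le> 1 / 2 ^ m" and q: "?q \<le> t'" "t' - ?q \<le> 1 / 2 ^ m"
    by (simp_all add: add_divide_distrib)
  \<comment> \<open>An interval longer than the mesh contains a grid point, so the two roundings do
    not cross.\<close>
  have "t * 2 ^ m + 1 < t' * 2 ^ m" using False by (simp add: field_simps)
  then have "\<lceil>t * 2 ^ m\<rceil> \<le> \<lfloor>t' * 2 ^ m\<rfloor>" by linarith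
  then have nn: "n \<le> n'" unfolding n_def n'_def by (rule nat_mono)
  have "t' * 2 ^ m \<le> 1 * 2 ^ m" using t by (intro mult_right_mono) auto
  with \<open>real n' \<le> t' * 2 ^ m\<close> have "real n' \<le> 1 * 2 ^ m" by (rule order_trans)
  then have "real n' \<le> real (2 ^ m)" by simp
  then have n': "n' \<le> 2 ^ m" by (simp only: of_nat_le_iff)
  have pq: "?p \<le> ?q" using nn by (simp add: divide_right_mono)
  let ?K = "\<lambda>x. C * pairing_const * x powr (1/2 - a)"
  have mono: "?K x \<le> ?K (t' - t)" if "0 \<le> x" "x \<le> t' - t" for x
    using that f pairing_const_nonneg a_less by (intro mult_left_mono powr_mono2) (auto simp: holder_le_def)
  have "\<bar>?I ?p - ?I t\<bar> \<le> ?K (?p - t)"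
    using p q pq t order_trans[OF nn n'] n' by (intro dyadic_integral_short_diff_le[OF f]) auto
  also have "\<dots> \<le> ?K (t' - t)" using p q pq by (intro mono) auto
  finally have 1: "\<bar>?I ?p - ?I t\<bar> \<le> ?K (t' - t)" .
  have "\<bar>?I t' - ?I ?q\<bar> \<le> ?K (t' - ?q)"
    using p q pq t order_trans[OF nn n'] n' by (intro dyadic_integral_short_diff_le[OF f]) auto
  also have "\<dots> \<le> ?K (t' - t)" using p q pq by (intro mono) auto
  finally have 2: "\<bar>?I t' - ?I ?q\<bar> \<le> ?K (t' - t)" .
  have "\<bar>?I ?q - ?I ?p\<bar> \<le> 3 * ?K (?q - ?p)"
    using dyadic_integral_grid_diff_le[OF f nn n'] by simp
  also have "\<dots> \<le> 3 * ?K (t' - t)" using p q pq by (intro mult_left_mono mono) auto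
  finally have "\<bar>?I t' - ?I t\<bar> \<le> 5 * ?K (t' - t)" using 1 2 by linarith
  then show ?thesis by simp
qed

end

section \<open>Passage to the limit in the mesh\<close>

context square_integrable_pairing
begin

text \<open>The common Hoelder constant supplies the dominating function: the exponent
  \<open>(1/2 - a) + (- a - 1) = - (1/2) - 2 * a\<close> exceeds \<open>- 1\<close>.\<close>

lemma vstar_tendsto:
  assumes f: "\<And>m. holder_le a C (f m)" and f': "f' \<in> borel_measurable borel"
    and lim: "\<And>r. r \<in> {0..1} \<Longrightarrow> (\<lambda>m. f m r) \<longlonglongrightarrow> f' r" and t: "t \<le> 1"
  shows "(\<lambda>m. vstar a (f m) t u) \<longlonglongrightarrow> vstar a f' t u"
proof (cases "0 < u \<and> u < t")
  case True
  then have u: "0 < u" "u < t" "u \<in> {0..1}" using t by auto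
  have [measurable]: "f m \<in> borel_measurable borel" "f' \<in> borel_measurable borel" for m
    using f[of m] f' by (auto simp: holder_le_def)
  define w where "w r = C * a * (indicator {u..t} r * (r - u) powr (- (1/2) - 2 * a))" for r
  have "(\<lambda>m. LINT r:{u..t}|lborel. (f m r - f m u) * vdensity a r u)
      \<longlonglongrightarrow> (LINT r:{u..t}|lborel. (f' r - f' u) * vdensity a r u)"
    unfolding set_lebesgue_integral_def
  proof (rule integral_dominated_convergence[where w=w])
    show "integrable lborel w"
      using set_integrable_powr_minus_left[of u u t "- (1/2) - 2 * a"] u a_less
      unfolding w_def set_integrable_def by (intro integrable_mult_right) simp
    show "AE r in lborel. (\<lambda>m. indicator {u..t} r *\<^sub>R ((f m r - f m u) * vdensity a r u))
        \<longlonglongrightarrow> indicator {u..t} r *\<^sub>R ((f' r - f' u) * vdensity a r u)"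
    proof (rule AE_I2)
      fix r
      show "(\<lambda>m. indicator {u..t} r *\<^sub>R ((f m r - f m u) * vdensity a r u))
          \<longlonglongrightarrow> indicator {u..t} r *\<^sub>R ((f' r - f' u) * vdensity a r u)"
      proof (cases "r \<in> {u..t}")
        case True
        then have "r \<in> {0..1}" using u t by auto
        then show ?thesis by (intro tendsto_intros lim u)
      qed simp
    qed
    fix m
    show "AE r in lborel. norm (indicator {u..t} r *\<^sub>R ((f m r - f m u) * vdensity a r u)) \<le> w r"
    proof (rule AE_I2)
      fix r
      consider "r \<notin> {u..t}" | "r = u" | "u < r" "r \<le> t" by fastforce
      then show "norm (indicator {u..t} r *\<^sub>R ((f m r - f m u) * vdensity a r u)) \<le> w r"
      proof cases
        case 3
        have "\<bar>f m r - f m u\<bar> * \<bar>vdensity a r u\<bar>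
            \<le> C * (r - u) powr (1/2 - a) * (a * (r - u) powr (- a - 1))"
          using 3 u t holder_le_diff[OF f, of u r m] vdensity_bounds(2)[of u r] f[of m]
          by (intro mult_mono) (auto simp: holder_le_def)
        also have "\<dots> = C * a * ((r - u) powr (1/2 - a) * (r - u) powr (- a - 1))"
          by (simp add: mult_ac)
        also have "(r - u) powr (1/2 - a) * (r - u) powr (- a - 1) = (r - u) powr (- (1/2) - 2 * a)"
          unfolding powr_add[symmetric] by (rule arg_cong[where f="\<lambda>e. (r - u) powr e"]) simp
        finally show ?thesis using 3 by (simp add: w_def abs_mult)
      qed (auto simp: w_def)
    qed
  qed measurable
  then show ?thesis
    using u lim[OF u(3)] unfolding vstar_def by (simp add: tendsto_intros)
qed (auto simp: vstar_def)

lemma star_pairing_tendsto: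
  assumes f: "\<And>m. holder_le a C (f m)" and f': "f' \<in> borel_measurable borel"
    and lim: "\<And>r. r \<in> {0..1} \<Longrightarrow> (\<lambda>m. f m r) \<longlonglongrightarrow> f' r" and t: "0 \<le> t" "t \<le> 1"
  shows "(\<lambda>m. star_pairing a g (f m) t) \<longlonglongrightarrow> star_pairing a g f' t"
  unfolding star_pairing_def
proof (rule integral_dominated_convergence)
  have [measurable]: "f m \<in> borel_measurable borel" "f' \<in> borel_measurable borel" for m
    using f[of m] f' by (auto simp: holder_le_def)
  have meas: "(\<lambda>u. vstar a h t u) \<in> borel_measurable lebesgue" if "h \<in> borel_measurable borel" for h
    using vstar_measurable[OF that] by (intro measurable_completion) simp
  note [measurable] = g_meas
  show "(\<lambda>u. vstar a f' t u * g u) \<in> borel_measurable lebesgue"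
    "(\<lambda>u. vstar a (f m) t u * g u) \<in> borel_measurable lebesgue" for m
    using meas[OF f'] meas[of "f m"] by auto
  have j: "jumps_le a 0 (\<lambda>_. 1) 0 0 t" using t by (intro jumps_le_none) auto
  \<comment> \<open>With \<open>0\<close> as the earlier time the envelope bounds the square of
    \<open>vstar\<close> itself; Young's inequality with weight \<open>1\<close> then dominates the
    product with \<open>g\<close>.\<close>
  let ?E = "star_envelope a 0 (\<lambda>_. 1) 0 t"
  have "integrable lebesgue ?E"
    using integrable_star_envelope[OF order_refl t j]
    by (subst integrable_completion) (auto intro: borel_measurable_integrable)
  then show "integrable lebesgue (\<lambda>u. (C\<^sup>2 * ?E u + (g u)\<^sup>2) / 2)"
    using g_square by (intro integrable_divide Bochner_Integration.integrable_add integrable_mult_right)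
  show "AE u in lebesgue. (\<lambda>m. vstar a (f m) t u * g u) \<longlonglongrightarrow> vstar a f' t u * g u"
    using vstar_tendsto[OF f f' lim t(2)] by (intro AE_I2 tendsto_intros)
  fix m
  show "AE u in lebesgue. norm (vstar a (f m) t u * g u) \<le> (C\<^sup>2 * ?E u + (g u)\<^sup>2) / 2"
    using AE_lebesgue_neq[of 0] AE_lebesgue_neq[of t]
  proof eventually_elim
    case (elim u)
    have "(vstar a (f m) t u)\<^sup>2 \<le> C\<^sup>2 * ?E u"
      using vstar_diff_square_le[OF oscillation_le_of_holder[OF f[of m]] order_refl t, of u] elim by simp
    then show ?case using abs_mult_le_weighted[of 1 "vstar a (f m) t u" "g u"] by simp
  qed
qed

lemma holder_le_limit:
  assumes f: "\<And>m. holder_le a C (f m)" and f': "f' \<in> borel_measurable borel"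
    and lim: "\<And>r. r \<in> {0..1} \<Longrightarrow> (\<lambda>m. f m r) \<longlonglongrightarrow> f' r"
  shows "holder_le a C f'"
  unfolding holder_le_def
proof (intro conjI ballI)
  show "0 < C" using f[of 0] by (simp add: holder_le_def)
  fix r :: real assume r: "r \<in> {0..1}"
  show "\<bar>f' r\<bar> \<le> C"
    using f r by (intro LIMSEQ_le_const2[OF tendsto_rabs[OF lim[OF r]]]) (auto simp: holder_le_def)
  fix u :: real assume u: "u \<in> {0..1}"
  show "\<bar>f' r - f' u\<bar> \<le> C * \<bar>r - u\<bar> powr (1/2 - a)"
    using f r u by (intro LIMSEQ_le_const2[OF tendsto_rabs[OF tendsto_diff[OF lim[OF r] lim[OF u]]]])
      (auto simp: holder_le_def)
qed (rule f')

lemma tendsto_powr_mesh: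
  assumes "0 < e"
  shows "(\<lambda>m. (1 / 2 ^ m :: real) powr e) \<longlonglongrightarrow> 0"
proof -
  have "(\<lambda>m. 1 / 2 ^ m :: real) \<longlonglongrightarrow> 0"
    using LIMSEQ_power_zero[of "1/2 :: real"] by (simp add: power_one_over)
  then show ?thesis
    using assms by (intro tendsto_zero_powrI[where b=e]) auto
qed

text \<open>The integrand may change with the mesh, as it must when it is itself the lower level of
  the lift of the same interpolation. Pointwise convergence of \<open>f m\<close> suffices because
  the Hoelder constant \<open>C\<close> is common to all \<open>m\<close>.\<close>

theorem dyadic_integral_tendsto:
  assumes f: "\<And>m. holder_le a C (f m)" and f': "f' \<in> borel_measurable borel"
    and lim: "\<And>r. r \<in> {0..1} \<Longrightarrow> (\<lambda>m. f m r) \<longlonglongrightarrow> f' r" and t: "0 \<le> t" "t \<le> 1"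
  shows "(\<lambda>m. dyadic_integral m path (f m) t) \<longlonglongrightarrow> star_pairing a g f' t"
proof -
  define n where "n m = nat \<lfloor>t * 2 ^ m\<rfloor>" for m :: nat
  define s where "s m = real (n m) / 2 ^ m" for m
  define \<psi> where "\<psi> m = (\<lambda>r. f m r - dyadic_mean m (f m) \<lfloor>r * 2 ^ m\<rfloor>)" for m
  have C: "0 < C" using f[of 0] by (simp add: holder_le_def)
  have n: "real (n m) = \<lfloor>t * 2 ^ m\<rfloor>" for m using t by (simp add: n_def)
  have s: "0 \<le> s m" "s m \<le> t" "t - s m \<le> 1 / 2 ^ m" for m
  proof -
    have "real (n m) \<le> t * 2 ^ m" "t * 2 ^ m \<le> real (n m) + 1" unfolding n by linarith+
    then have "s m \<le> t" "t \<le> (real (n m) + 1) / 2 ^ m"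
      by (auto simp: s_def divide_le_eq le_divide_eq)
    then show "s m \<le> t" "t - s m \<le> 1 / 2 ^ m"
      by (simp_all add: s_def add_divide_distrib)
  qed (simp add: s_def)
  have nm: "n m \<le> 2 ^ m" for m
  proof -
    have "real (n m) / 2 ^ m \<le> 1" using order_trans[OF s(2)[of m] t(2)] by (simp only: s_def)
    then show ?thesis by simp
  qed
  let ?I = "\<lambda>m. dyadic_integral m path (f m)" and ?P = "star_pairing a g"
  \<comment> \<open>Rounding \<open>t\<close> down to the grid costs \<open>5\<close> for the dyadic
    integral and \<open>1\<close> for the pairing. The second term is the pairing of the error
    \<open>\<psi> m\<close>, the third the convergence of the integrands.\<close>
  let ?e = "\<lambda>m. 6 * C * pairing_const * (1 / 2 ^ m) powr (1/2 - a)
      + 2 * C * pairing_const * (1 / 2 ^ m) powr (1/4 - a) + \<bar>?P (f m) t - ?P f' t\<bar>"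
  have bound: "\<bar>?I m t - ?P f' t\<bar> \<le> ?e m" for m
  proof -
    have mono: "(t - s m) powr (1/2 - a) \<le> (1 / 2 ^ m) powr (1/2 - a)"
      using s[of m] a_less by (intro powr_mono2) auto
    have "\<bar>?I m t - ?I m (s m)\<bar> \<le> 5 * C * pairing_const * (t - s m) powr (1/2 - a)"
      using s[of m] t by (intro dyadic_integral_diff_le[OF f]) auto
    also have "\<dots> \<le> 5 * C * pairing_const * (1 / 2 ^ m) powr (1/2 - a)"
      using C pairing_const_nonneg by (intro mult_left_mono mono) auto
    finally have 1: "\<bar>?I m t - ?I m (s m)\<bar> \<le> 5 * C * pairing_const * (1 / 2 ^ m) powr (1/2 - a)" .
    have "\<bar>?P (f m) t - ?P (f m) (s m)\<bar> \<le> C * pairing_const * (t - s m) powr (1/2 - a)"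
      using s[of m] t by (intro pairing_holder_diff_le[OF f]) auto
    also have "\<dots> \<le> C * pairing_const * (1 / 2 ^ m) powr (1/2 - a)"
      using C pairing_const_nonneg by (intro mult_left_mono mono) auto
    finally have 2: "\<bar>?P (f m) t - ?P (f m) (s m)\<bar> \<le> C * pairing_const * (1 / 2 ^ m) powr (1/2 - a)" .
    have "\<bar>?P (\<psi> m) (s m)\<bar>
        \<le> 2 * C * (1 / 2 ^ m) powr (1/4 - a) * pairing_const * (s m) powr (1/2 - a)"
      using pairing_error_diff_le[OF f le0 nm, of m m] by (simp add: \<psi>_def s_def)
    also have "\<dots> \<le> 2 * C * (1 / 2 ^ m) powr (1/4 - a) * pairing_const * 1"
      using C pairing_const_nonneg s[of m] t a_less by (intro mult_left_mono powr_le1) auto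
    finally have 3: "\<bar>?P (\<psi> m) (s m)\<bar> \<le> 2 * C * pairing_const * (1 / 2 ^ m) powr (1/4 - a)"
      by (simp add: mult_ac)
    have "?I m (s m) = ?P (f m) (s m) - ?P (\<psi> m) (s m)"
      using dyadic_integral_eq[OF f nm, of m m] by (simp add: \<psi>_def s_def)
    then have "\<bar>?I m t - ?P f' t\<bar> \<le> \<bar>?I m t - ?I m (s m)\<bar> + \<bar>?P (\<psi> m) (s m)\<bar>
        + \<bar>?P (f m) t - ?P (f m) (s m)\<bar> + \<bar>?P (f m) t - ?P f' t\<bar>" by linarith
    then show ?thesis using 1 2 3 by linarith
  qed
  have "?e \<longlonglongrightarrow> 6 * C * pairing_const * 0 + 2 * C * pairing_const * 0 + \<bar>?P f' t - ?P f' t\<bar>"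
    using a_less by (intro tendsto_intros tendsto_powr_mesh star_pairing_tendsto[OF f f' lim t]) auto
  then have "?e \<longlonglongrightarrow> 0" by simp
  then have "(\<lambda>m. ?I m t - ?P f' t) \<longlonglongrightarrow> 0"
    by (rule Lim_null_comparison[rotated]) (use bound in \<open>auto intro!: always_eventually\<close>)
  then show ?thesis by (simp add: LIM_zero_iff)
qed

end


section \<open>Iterated integrals of dyadic interpolations\<close>

lemma bounded_linear_axis: "bounded_linear (\<lambda>x :: 'b::euclidean_space. axis i x :: 'b ^ 'n)"
  unfolding linear_conv_bounded_linear[symmetric]
  by (rule linearI) (auto simp: vec_eq_iff axis_def)

lemma integrable_vec:
  fixes f :: "'a \<Rightarrow> 'b::euclidean_space ^ 'n"
  assumes "\<And>i. integrable M (\<lambda>x. f x $ i)"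
  shows "integrable M f"
proof -
  have "f x = (\<Sum>i\<in>UNIV. axis i (f x $ i))" for x
    by (simp add: vec_eq_iff axis_def)
  then have eq: "f = (\<lambda>x. \<Sum>i\<in>UNIV. axis i (f x $ i))" by blast
  show ?thesis
    by (subst eq) (intro Bochner_Integration.integrable_sum integrable_bounded_linear[OF bounded_linear_axis] assms)
qed

lemma
  fixes f :: "'a \<Rightarrow> 'b::euclidean_space ^ 'n"
  assumes "\<And>i. set_integrable M S (\<lambda>x. f x $ i)"
  shows set_integrable_vec: "set_integrable M S f"
    and LINT_vec_nth: "(LINT x:S|M. f x) $ i = (LINT x:S|M. f x $ i)"
proof -
  show *: "set_integrable M S f"
    using assms unfolding set_integrable_def by (intro integrable_vec) simp
  show "(LINT x:S|M. f x) $ i = (LINT x:S|M. f x $ i)"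
    using integral_bounded_linear[OF bounded_linear_vec_nth[of i] *[unfolded set_integrable_def]]
    by (simp add: set_lebesgue_integral_def)
qed

section \<open>Dyadic interpolations off the grid\<close>

lemma negligible_dyadic_grid: "negligible {r::real. r * 2 ^ m \<in> \<int>}"
proof -
  have "{r::real. r * 2 ^ m \<in> \<int>} \<subseteq> (\<lambda>l. real_of_int l / 2 ^ m) ` UNIV"
    by (force simp: Ints_def field_simps)
  then have "countable {r::real. r * 2 ^ m \<in> \<int>}"
    by (rule countable_subset) simp
  then show ?thesis
    by (simp add: negligible_iff_null_sets countable_imp_null_set_lborel null_sets_completionI)
qed

text \<open>The iterated integrals run over open intervals and involve a derivative that is known
  only off the grid; the endpoints and the grid are null sets.\<close>

lemma LINT_open_interval_spike:
  fixes f g :: "real \<Rightarrow> real"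
  assumes "f absolutely_integrable_on {s..t}" "negligible N" "\<And>r. r \<in> {s<..<t} - N \<Longrightarrow> g r = f r"
  shows "set_integrable lebesgue {s<..<t} g" "(LINT r:{s<..<t}|lebesgue. g r) = integral {s..t} f"
proof -
  have "f absolutely_integrable_on {s<..<t}"
    using assms(1) absolutely_integrable_on_open_interval[where f=f and a=s and b=t] by (simp add: cbox_interval box_real)
  then show g: "set_integrable lebesgue {s<..<t} g"
    using assms(2,3) by (rule absolutely_integrable_spike)
  have "(LINT r:{s<..<t}|lebesgue. g r) = integral {s<..<t} g"
    by (rule set_lebesgue_integral_eq_integral(2)[OF g])
  also have "\<dots> = integral {s<..<t} f"
    using assms(2,3) by (intro integral_spike) auto
  also have "\<dots> = integral {s..t} f"
    using integral_open_interval[where f=f and a=s and b=t] by (simp add: cbox_interval box_real)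
  finally show "(LINT r:{s<..<t}|lebesgue. g r) = integral {s..t} f" .
qed

lemma vector_derivative_dyadic_interpolation:
  fixes h :: "real \<Rightarrow> real ^ 'd"
  assumes "r * 2 ^ m \<notin> \<int>"
  shows "vector_derivative (dyadic_interpolation h m) (at r) $ i = dyadic_slope m (\<lambda>r. h r $ i) r"
proof -
  define l where "l = \<lfloor>r * 2 ^ m\<rfloor>"
  let ?\<Delta> = "h ((l + 1) / 2 ^ m) - h (l / 2 ^ m)"
  have "real_of_int l \<noteq> r * 2 ^ m" using assms by (metis Ints_of_int)
  then have "l < r * 2 ^ m" "r * 2 ^ m < l + 1" unfolding l_def by linarith+
  then have r: "r \<in> {l / 2 ^ m<..<(l + 1) / 2 ^ m}" by (simp add: field_simps)
  have "((\<lambda>u. h (l / 2 ^ m) + (u * 2 ^ m - l) *\<^sub>R ?\<Delta>) has_vector_derivative 2 ^ m *\<^sub>R ?\<Delta>) (at r)"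
    by (auto intro!: derivative_eq_intros simp: has_vector_derivative_def)
  then have "(dyadic_interpolation h m has_vector_derivative 2 ^ m *\<^sub>R ?\<Delta>) (at r)"
  proof (rule has_vector_derivative_transform_within_open[OF _ open_greaterThanLessThan r])
    fix u assume "u \<in> {l / 2 ^ m<..<(l + 1) / 2 ^ m}"
    then have "\<lfloor>u * 2 ^ m\<rfloor> = l" by (intro floor_unique) (auto simp: field_simps)
    then show "h (l / 2 ^ m) + (u * 2 ^ m - l) *\<^sub>R ?\<Delta> = dyadic_interpolation h m u"
      by (simp add: dyadic_interpolation_def Let_def)
  qed
  from vector_derivative_at[OF this] show ?thesis
    by (simp add: dyadic_slope_def l_def)
qed

lemma absolutely_integrable_dyadic_slope:
  assumes "continuous_on {s..t} f" "0 \<le> s" "t \<le> 1"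
  shows "(\<lambda>r. f r * dyadic_slope m y r) absolutely_integrable_on {s..t}"
proof -
  let ?c = "\<lambda>l::int. 2 ^ m * (y ((l + 1) / 2 ^ m) - y (l / 2 ^ m))"
  have "(\<lambda>r::real. ?c \<lfloor>r * 2 ^ m\<rfloor>) \<in> borel_measurable borel"
    by measurable
  then have "dyadic_slope m y \<in> borel_measurable borel"
    by (simp add: dyadic_slope_def[abs_def])
  then have meas: "dyadic_slope m y \<in> borel_measurable (lebesgue_on {s..t})"
    by (intro measurable_restrict_space1 measurable_completion) simp
  \<comment> \<open>The slope takes finitely many values. The index range is closed because
    \<open>r = 1\<close> has index \<open>2 ^ m\<close>.\<close>
  have "dyadic_slope m y ` {s..t} \<subseteq> ?c ` {0..2 ^ m}"
  proof
    fix v assume "v \<in> dyadic_slope m y ` {s..t}"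
    then obtain r where r: "r \<in> {s..t}" "v = ?c \<lfloor>r * 2 ^ m\<rfloor>" by (auto simp: dyadic_slope_def)
    have "r * 2 ^ m \<le> 1 * 2 ^ m" using r assms by (intro mult_right_mono) auto
    then have "\<lfloor>r * 2 ^ m\<rfloor> \<le> \<lfloor>1 * 2 ^ m :: real\<rfloor>" by (rule floor_mono)
    moreover have "\<lfloor>1 * 2 ^ m :: real\<rfloor> = 2 ^ m"
      using floor_of_int[of "2 ^ m", where 'a=real] by simp
    ultimately have "\<lfloor>r * 2 ^ m\<rfloor> \<in> {0..2 ^ m}" using r assms by simp
    then show "v \<in> ?c ` {0..2 ^ m}" unfolding r(2) by (rule imageI)
  qed
  then have "bounded (dyadic_slope m y ` {s..t})"
    by (intro finite_imp_bounded) (rule finite_subset, auto)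
  then have "(\<lambda>r. dyadic_slope m y r * f r) absolutely_integrable_on {s..t}"
    using assms by (intro absolutely_integrable_bounded_measurable_product_real meas absolutely_integrable_continuous_real) auto
  then show ?thesis by (simp add: mult.commute)
qed

text \<open>Scalar components of the iterated integrals. In contrast to
  \<open>dyadic_integral\<close> the lower limit is free, as Chen's relation requires.\<close>

definition slope_integral1 :: "nat \<Rightarrow> (real \<Rightarrow> real) \<Rightarrow> real \<Rightarrow> real \<Rightarrow> real" where
  "slope_integral1 m x s t = integral {s..t} (dyadic_slope m x)"

definition slope_integral2 :: "nat \<Rightarrow> (real \<Rightarrow> real) \<Rightarrow> (real \<Rightarrow> real) \<Rightarrow> real \<Rightarrow> real \<Rightarrow> real" where
  "slope_integral2 m x y s t = integral {s..t} (\<lambda>r. slope_integral1 m x s r * dyadic_slope m y r)"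

definition slope_integral3 ::
    "nat \<Rightarrow> (real \<Rightarrow> real) \<Rightarrow> (real \<Rightarrow> real) \<Rightarrow> (real \<Rightarrow> real) \<Rightarrow> real \<Rightarrow> real \<Rightarrow> real" where
  "slope_integral3 m x y z s t = integral {s..t} (\<lambda>r. slope_integral2 m x y s r * dyadic_slope m z r)"

lemma absolutely_integrable_dyadic_slope1:
  assumes "0 \<le> s" "t \<le> 1"
  shows "dyadic_slope m x absolutely_integrable_on {s..t}"
  using absolutely_integrable_dyadic_slope[of s t "\<lambda>_. 1" m x] assms by simp

lemma continuous_on_slope_integral1:
  assumes "0 \<le> s" "t \<le> 1"
  shows "continuous_on {s..t} (slope_integral1 m x s)"
  unfolding slope_integral1_def[abs_def]
  using absolutely_integrable_dyadic_slope1[OF assms] set_lebesgue_integral_eq_integral(1)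
  by (intro indefinite_integral_continuous_1) blast

lemma continuous_on_slope_integral2:
  assumes "0 \<le> s" "t \<le> 1"
  shows "continuous_on {s..t} (slope_integral2 m x y s)"
  unfolding slope_integral2_def[abs_def]
  using absolutely_integrable_dyadic_slope[OF continuous_on_slope_integral1[OF assms] assms] set_lebesgue_integral_eq_integral(1)
  by (intro indefinite_integral_continuous_1) blast

lemma integrable_on_continuous_dyadic_slope:
  assumes "continuous_on {s..t} f" "0 \<le> s" "t \<le> 1"
  shows "(\<lambda>r. f r * dyadic_slope m y r) integrable_on {s..t}"
  by (rule set_lebesgue_integral_eq_integral(1)[OF absolutely_integrable_dyadic_slope[OF assms]])

section \<open>Components of the lifts of the interpolations\<close>

lemma iterated_integral1_nth:
  assumes "0 \<le> s" "t \<le> 1"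
  shows "iterated_integral1 (dyadic_interpolation h m) s t $ i = slope_integral1 m (\<lambda>r. h r $ i) s t"
proof -
  note * = LINT_open_interval_spike[OF absolutely_integrable_dyadic_slope1[OF assms] negligible_dyadic_grid]
  have D: "vector_derivative (dyadic_interpolation h m) (at r) $ i = dyadic_slope m (\<lambda>r. h r $ i) r"
    if "r \<in> {s<..<t} - {r. r * 2 ^ m \<in> \<int>}" for r i
    using that by (simp add: vector_derivative_dyadic_interpolation)
  have "set_integrable lebesgue {s<..<t} (\<lambda>r. vector_derivative (dyadic_interpolation h m) (at r) $ i)" for i
    by (rule *(1)) (rule D)
  then have "iterated_integral1 (dyadic_interpolation h m) s t $ i
      = (LINT r:{s<..<t}|lebesgue. vector_derivative (dyadic_interpolation h m) (at r) $ i)"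
    unfolding iterated_integral1_def by (rule LINT_vec_nth)
  also have "\<dots> = slope_integral1 m (\<lambda>r. h r $ i) s t"
    unfolding slope_integral1_def by (rule *(2)) (rule D)
  finally show ?thesis .
qed

lemma iterated_integral2_nth:
  assumes "0 \<le> s" "t \<le> 1"
  shows "iterated_integral2 (dyadic_interpolation h m) s t $ i $ j
    = slope_integral2 m (\<lambda>r. h r $ i) (\<lambda>r. h r $ j) s t"
proof -
  let ?x = "dyadic_interpolation h m"
  let ?F = "\<lambda>r. tensor2 (iterated_integral1 ?x s r) (vector_derivative ?x (at r))"
  have F: "?F r $ i $ j = slope_integral1 m (\<lambda>r. h r $ i) s r * dyadic_slope m (\<lambda>r. h r $ j) r"
    if "r \<in> {s<..<t} - {r. r * 2 ^ m \<in> \<int>}" for r i j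
    using that assms by (simp add: tensor2_def iterated_integral1_nth vector_derivative_dyadic_interpolation)
  note * = LINT_open_interval_spike[OF absolutely_integrable_dyadic_slope
      [OF continuous_on_slope_integral1[OF assms] assms] negligible_dyadic_grid]
  have int: "set_integrable lebesgue {s<..<t} (\<lambda>r. ?F r $ i $ j)" for i j
    by (rule *(1)) (rule F)
  have "iterated_integral2 ?x s t $ i $ j = (LINT r:{s<..<t}|lebesgue. ?F r $ i) $ j"
    unfolding iterated_integral2_def by (subst LINT_vec_nth) (intro set_integrable_vec int refl)+
  also have "\<dots> = (LINT r:{s<..<t}|lebesgue. ?F r $ i $ j)"
    by (rule LINT_vec_nth) (rule int)
  also have "\<dots> = slope_integral2 m (\<lambda>r. h r $ i) (\<lambda>r. h r $ j) s t"
    unfolding slope_integral2_def by (rule *(2)) (rule F)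
  finally show ?thesis .
qed

lemma iterated_integral3_nth:
  assumes "0 \<le> s" "t \<le> 1"
  shows "iterated_integral3 (dyadic_interpolation h m) s t $ i $ j $ k
    = slope_integral3 m (\<lambda>r. h r $ i) (\<lambda>r. h r $ j) (\<lambda>r. h r $ k) s t"
proof -
  let ?x = "dyadic_interpolation h m"
  let ?F = "\<lambda>r. tensor3 (iterated_integral2 ?x s r) (vector_derivative ?x (at r))"
  have F: "?F r $ i $ j $ k
      = slope_integral2 m (\<lambda>r. h r $ i) (\<lambda>r. h r $ j) s r * dyadic_slope m (\<lambda>r. h r $ k) r"
    if "r \<in> {s<..<t} - {r. r * 2 ^ m \<in> \<int>}" for r i j k
    using that assms by (simp add: tensor3_def iterated_integral2_nth vector_derivative_dyadic_interpolation)
  note * = LINT_open_interval_spike[OF absolutely_integrable_dyadic_slope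
      [OF continuous_on_slope_integral2[OF assms] assms] negligible_dyadic_grid]
  have int: "set_integrable lebesgue {s<..<t} (\<lambda>r. ?F r $ i $ j $ k)" for i j k
    by (rule *(1)) (rule F)
  have "iterated_integral3 ?x s t $ i $ j $ k = (LINT r:{s<..<t}|lebesgue. ?F r $ i) $ j $ k"
    unfolding iterated_integral3_def by (subst LINT_vec_nth) (intro set_integrable_vec int refl)+
  also have "(LINT r:{s<..<t}|lebesgue. ?F r $ i) $ j = (LINT r:{s<..<t}|lebesgue. ?F r $ i $ j)"
    by (rule LINT_vec_nth) (intro set_integrable_vec int)
  also have "\<dots> $ k = (LINT r:{s<..<t}|lebesgue. ?F r $ i $ j $ k)"
    by (rule LINT_vec_nth) (rule int)
  also have "\<dots> = slope_integral3 m (\<lambda>r. h r $ i) (\<lambda>r. h r $ j) (\<lambda>r. h r $ k) s t"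
    unfolding slope_integral3_def by (rule *(2)) (rule F)
  finally show ?thesis .
qed

section \<open>Chen's relation for the interpolations\<close>

lemma slope_integral1_split:
  assumes "0 \<le> q" "q \<le> s" "s \<le> t" "t \<le> 1"
  shows "slope_integral1 m x q t = slope_integral1 m x q s + slope_integral1 m x s t"
  unfolding slope_integral1_def
  using assms set_lebesgue_integral_eq_integral(1)[OF absolutely_integrable_dyadic_slope1[of q t m x]]
  by (intro Henstock_Kurzweil_Integration.integral_combine[symmetric]) auto

text \<open>For \<open>r\<close> in \<open>{s..t}\<close> the inner integral from \<open>q\<close>
  splits at \<open>s\<close> into a constant and the integral from \<open>s\<close>; integrating the
  constant produces the product term.\<close>

lemma slope_integral2_split:
  assumes "0 \<le> q" "q \<le> s" "s \<le> t" "t \<le> 1"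
  shows "slope_integral2 m x y q t
    = slope_integral2 m x y q s + slope_integral1 m x q s * slope_integral1 m y s t + slope_integral2 m x y s t"
proof -
  let ?F = "\<lambda>q r. slope_integral1 m x q r * dyadic_slope m y r"
  have i: "?F r integrable_on {r..t}" if "0 \<le> r" for r
    using that assms by (intro integrable_on_continuous_dyadic_slope continuous_on_slope_integral1) auto
  have i1: "dyadic_slope m y integrable_on {s..t}"
    using set_lebesgue_integral_eq_integral(1)[OF absolutely_integrable_dyadic_slope1[of s t m y]] assms by auto
  have "slope_integral2 m x y q t = slope_integral2 m x y q s + integral {s..t} (?F q)"
    unfolding slope_integral2_def using assms i[of q]
    by (intro Henstock_Kurzweil_Integration.integral_combine[symmetric]) auto
  also have "integral {s..t} (?F q)
      = integral {s..t} (\<lambda>r. slope_integral1 m x q s * dyadic_slope m y r + ?F s r)"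
  proof (rule integral_cong)
    fix r assume "r \<in> {s..t}"
    then have "slope_integral1 m x q r = slope_integral1 m x q s + slope_integral1 m x s r"
      using assms by (intro slope_integral1_split) auto
    then show "?F q r = slope_integral1 m x q s * dyadic_slope m y r + ?F s r"
      by (simp add: algebra_simps)
  qed
  also have "\<dots> = slope_integral1 m x q s * slope_integral1 m y s t + slope_integral2 m x y s t"
    unfolding slope_integral1_def[of m y s t] slope_integral2_def[of m x y s t] using i[of s] i1 assms
    by (intro integral_unique has_integral_add has_integral_mult_right integrable_integral) auto
  finally show ?thesis by simp
qed

text \<open>The same argument, with the relation of level two inserted for the inner
  integral.\<close>

lemma slope_integral3_split:
  assumes "0 \<le> q" "q \<le> s" "s \<le> t" "t \<le> 1"
  shows "slope_integral3 m x y z q t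
    = slope_integral3 m x y z q s + slope_integral2 m x y q s * slope_integral1 m z s t
      + slope_integral1 m x q s * slope_integral2 m y z s t + slope_integral3 m x y z s t"
proof -
  let ?F = "\<lambda>q r. slope_integral2 m x y q r * dyadic_slope m z r"
  let ?G = "\<lambda>r. slope_integral1 m y s r * dyadic_slope m z r"
  have i: "?F r integrable_on {r..t}" if "0 \<le> r" for r
    using that assms by (intro integrable_on_continuous_dyadic_slope continuous_on_slope_integral2) auto
  have i1: "dyadic_slope m z integrable_on {s..t}"
    using set_lebesgue_integral_eq_integral(1)[OF absolutely_integrable_dyadic_slope1[of s t m z]] assms by auto
  have i2: "?G integrable_on {s..t}"
    using assms by (intro integrable_on_continuous_dyadic_slope continuous_on_slope_integral1) auto
  have "slope_integral3 m x y z q t = slope_integral3 m x y z q s + integral {s..t} (?F q)"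
    unfolding slope_integral3_def using assms i[of q]
    by (intro Henstock_Kurzweil_Integration.integral_combine[symmetric]) auto
  also have "integral {s..t} (?F q) = integral {s..t} (\<lambda>r. slope_integral2 m x y q s * dyadic_slope m z r
      + slope_integral1 m x q s * ?G r + ?F s r)"
  proof (rule integral_cong)
    fix r assume "r \<in> {s..t}"
    then have "slope_integral2 m x y q r = slope_integral2 m x y q s
        + slope_integral1 m x q s * slope_integral1 m y s r + slope_integral2 m x y s r"
      using assms by (intro slope_integral2_split) auto
    then show "?F q r = slope_integral2 m x y q s * dyadic_slope m z r + slope_integral1 m x q s * ?G r + ?F s r"
      by (simp add: algebra_simps)
  qed
  also have "\<dots> = slope_integral2 m x y q s * slope_integral1 m z s t
      + slope_integral1 m x q s * slope_integral2 m y z s t + slope_integral3 m x y z s t"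
    unfolding slope_integral1_def[of m z s t] slope_integral2_def[of m y z s t] slope_integral3_def[of m x y z s t]
    using i[of s] i1 i2 assms
    by (intro integral_unique has_integral_add has_integral_mult_right integrable_integral) auto
  finally show ?thesis by simp
qed


section \<open>The representation formulas\<close>

context kernel_exponent
begin

lemma fbm_kernel_eq: "fbm_kernel (1/2 - a) t u = fbm_const (1/2 - a) * vkernel a t u"
  by (simp only: fbm_kernel_def volterra_kernel_eq)

lemma fbm_kernel_density_eq:
  assumes "0 < u" "u < r" "r < 1"
  shows "fbm_kernel_density (1/2 - a) r u = fbm_const (1/2 - a) * vdensity a r u"
proof -
  have "deriv (\<lambda>x. fbm_kernel (1/2 - a) x u) r = fbm_const (1/2 - a) * vdensity a r u"
    unfolding fbm_kernel_eq using vkernel_has_derivative[OF assms(1,2)]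
    by (intro DERIV_imp_deriv DERIV_cmult)
  then show ?thesis using assms by (simp add: fbm_kernel_density_def)
qed

text \<open>A Borel function \<open>f'\<close> stands in for \<open>f\<close>, whose values outside
  \<open>[0,1]\<close> are arbitrary. This gives access to the estimates for \<open>vstar\<close>,
  which is built on Borel measurable integrands.\<close>

lemma Kstar_upto_eq:
  assumes [measurable]: "f' \<in> borel_measurable borel" and f': "\<And>r. r \<in> {0..1} \<Longrightarrow> f' r = f r"
    and "t \<le> 1" "0 \<le> u"
  shows "Kstar_upto (1/2 - a) f t u = fbm_const (1/2 - a) * vstar a f' t u"
proof -
  let ?c = "fbm_const (1/2 - a)"
  consider "t \<le> u" | "u = 0" "0 < t" | "0 < u" "u < t" using assms by linarith
  then show ?thesis
  proof cases
    case 1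
    then show ?thesis by (simp add: Kstar_upto_def vstar_def)
  next
    \<comment> \<open>At \<open>u = 0\<close> the kernel is \<open>0\<close> at all times by
      convention, hence so is its derivative, and both sides vanish.\<close>
    case 2
    then show ?thesis
      by (simp add: Kstar_upto_def vstar_def fbm_kernel_density_def fbm_kernel_eq vkernel_def)
  next
    case 3
    have "(LINT r:{u..t}|lebesgue. (f r - f u) * fbm_kernel_density (1/2 - a) r u)
        = (LINT r|lebesgue. indicator {..<1} r * (indicator {u..t} r * ((f' r - f' u) * (?c * vdensity a r u))))"
      unfolding set_lebesgue_integral_def
    proof (rule Bochner_Integration.integral_cong[OF refl])
      fix r
      \<comment> \<open>The density carries the indicator of \<open>{u<..<1}\<close>; at
        \<open>r = u\<close> the increment of \<open>f\<close> vanishes too, and the part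
        \<open>1 \<le> r\<close> is matched by the indicator of \<open>{..<1}\<close>.\<close>
      consider "r \<notin> {u..t}" | "r = u" | "1 \<le> r" | "u < r" "r < 1" "r \<le> t" by fastforce
      then show "indicator {u..t} r *\<^sub>R ((f r - f u) * fbm_kernel_density (1/2 - a) r u)
          = indicator {..<1} r * (indicator {u..t} r * ((f' r - f' u) * (?c * vdensity a r u)))"
      proof cases
        case 4
        then show ?thesis using 3 fbm_kernel_density_eq[of u r] f'[of r] f'[of u] by simp
      qed (auto simp: fbm_kernel_density_def)
    qed
    also have "\<dots> = (LINT r|lborel. indicator {..<1} r * (indicator {u..t} r * ((f' r - f' u) * (?c * vdensity a r u))))"
      by (intro integral_completion) measurable
    also have "\<dots> = (LINT r|lborel. ?c * (indicator {u..t} r * ((f' r - f' u) * vdensity a r u)))"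
    proof (rule integral_cong_AE)
      show "AE r in lborel. indicator {..<1} r * (indicator {u..t} r * ((f' r - f' u) * (?c * vdensity a r u)))
          = ?c * (indicator {u..t} r * ((f' r - f' u) * vdensity a r u))"
        using AE_lborel_singleton[of 1] by eventually_elim (use assms in \<open>auto simp: indicator_def\<close>)
    qed measurable
    also have "\<dots> = ?c * (LINT r:{u..t}|lborel. (f' r - f' u) * vdensity a r u)"
      by (simp add: set_lebesgue_integral_def)
    finally show ?thesis
      using 3 assms f'[of u] by (simp add: Kstar_upto_def vstar_def fbm_kernel_eq algebra_simps)
  qed
qed

end

context square_integrable_pairing
begin

text \<open>The step from one level to the next: the constant does not depend on \<open>m\<close>.
  The summand \<open>1\<close> keeps it positive, and the cut-off outside \<open>[0,1]\<close> makes
  the function Borel on the whole line.\<close>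

lemma holder_le_dyadic_integral:
  assumes f: "holder_le a C f"
  shows "holder_le a (5 * C * pairing_const + 1) (\<lambda>r. if r \<in> {0..1} then dyadic_integral m path f r else 0)"
proof -
  let ?I = "dyadic_integral m path f" and ?K = "5 * C * pairing_const"
  have K: "0 \<le> ?K" using f pairing_const_nonneg by (simp add: holder_le_def)
  have le: "\<bar>?I r - ?I u\<bar> \<le> (?K + 1) * \<bar>r - u\<bar> powr (1/2 - a)" if "r \<in> {0..1}" "u \<in> {0..1}" for r u
  proof -
    have "\<bar>?I r - ?I u\<bar> \<le> ?K * \<bar>r - u\<bar> powr (1/2 - a)"
      using dyadic_integral_diff_le[OF f, of r u m] dyadic_integral_diff_le[OF f, of u r m] that
      by (cases "r \<le> u") (auto simp: abs_minus_commute)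
    also have "\<dots> \<le> (?K + 1) * \<bar>r - u\<bar> powr (1/2 - a)" by (intro mult_right_mono) auto
    finally show ?thesis .
  qed
  have abs: "\<bar>?I r\<bar> \<le> ?K + 1" if "r \<in> {0..1}" for r
  proof -
    have "\<bar>?I r\<bar> \<le> (?K + 1) * \<bar>r\<bar> powr (1/2 - a)"
      using le[OF that, of 0] by (simp add: dyadic_integral_def)
    also have "\<dots> \<le> (?K + 1) * 1"
      using K that a_less by (intro mult_left_mono powr_le1) auto
    finally show ?thesis by simp
  qed
  have "continuous_on {0..1} ?I"
    unfolding dyadic_integral_def
    by (intro indefinite_integral_continuous_1 integrable_on_dyadic_slope[OF f]) auto
  then have "(\<lambda>r. if r \<in> {0..1} then ?I r else 0) \<in> borel_measurable borel"
    by (intro borel_measurable_continuous_on_if) auto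
  then show ?thesis
    using K le abs by (simp add: holder_le_def)
qed

end

section \<open>Transfer from \<open>h\<close> to the paths given by pairings\<close>

lemma dyadic_slope_cong:
  assumes "\<And>u. u \<in> {0..1} \<Longrightarrow> x u = y u" and "0 \<le> r" "r < 1"
  shows "dyadic_slope m x r = dyadic_slope m y r"
  using floor_dyadic_bounds[OF assms(2,3), of m] assms by (simp add: dyadic_slope_def)

text \<open>Agreement on \<open>[0,1]\<close> fixes the slopes for \<open>r < 1\<close>; at
  \<open>r = 1\<close> they may differ, but a single point is negligible.\<close>

lemma dyadic_integral_cong:
  assumes "\<And>u. u \<in> {0..1} \<Longrightarrow> x u = y u" "\<And>r. r \<in> {0..1} \<Longrightarrow> f r = f' r" and "t \<le> 1"
  shows "integral {0..t} (\<lambda>r. f r * dyadic_slope m x r) = dyadic_integral m y f' t"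
  unfolding dyadic_integral_def
proof (rule integral_spike[of "{1}"])
  show "f' r * dyadic_slope m y r = f r * dyadic_slope m x r" if "r \<in> {0..t} - {1}" for r
    using that assms dyadic_slope_cong[of x y r m] by auto
qed simp

lemma slope_integral_eq_dyadic_integral:
  fixes x x' y y' z z' :: "real \<Rightarrow> real" and m :: nat
  assumes "\<And>u. u \<in> {0..1} \<Longrightarrow> x u = x' u" "\<And>u. u \<in> {0..1} \<Longrightarrow> y u = y' u" "\<And>u. u \<in> {0..1} \<Longrightarrow> z u = z' u"
  defines "F1 \<equiv> \<lambda>r. if r \<in> {0..1} then dyadic_integral m x' (\<lambda>_. 1) r else 0"
  defines "F2 \<equiv> \<lambda>r. if r \<in> {0..1} then dyadic_integral m y' F1 r else 0"
  assumes t: "t \<in> {0..1}"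
  shows "slope_integral1 m x 0 t = F1 t" "slope_integral2 m x y 0 t = F2 t"
    "slope_integral3 m x y z 0 t = dyadic_integral m z' F2 t"
proof -
  have 1: "slope_integral1 m x 0 t = F1 t" if "t \<in> {0..1}" for t
    using dyadic_integral_cong[of x x' "\<lambda>_. 1" "\<lambda>_. 1" t m] that assms(1)
    by (simp add: F1_def slope_integral1_def)
  have 2: "slope_integral2 m x y 0 t = F2 t" if "t \<in> {0..1}" for t
    using dyadic_integral_cong[of y y' "slope_integral1 m x 0" F1 t m] that assms(2) 1
    by (simp add: F2_def slope_integral2_def)
  show "slope_integral1 m x 0 t = F1 t" "slope_integral2 m x y 0 t = F2 t"
    using 1 2 t by auto
  show "slope_integral3 m x y z 0 t = dyadic_integral m z' F2 t"
    using dyadic_integral_cong[of z z' "slope_integral2 m x y 0" F2 t m] t assms(3) 2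
    by (simp add: slope_integral3_def)
qed

lemma
  fixes H :: real and hdot :: "real \<Rightarrow> real ^ 'd"
  assumes hdot: "hdot \<in> L2_unit"
  defines "g \<equiv> \<lambda>i u. indicator {0..1} u * (fbm_const H * hdot u $ i)"
  shows L2_unit_nth_measurable: "g i \<in> borel_measurable lebesgue"
    and L2_unit_nth_square: "integrable lebesgue (\<lambda>u. (g i u)\<^sup>2)"
proof -
  have "(\<lambda>u. indicator {0..1} u *\<^sub>R hdot u) \<in> borel_measurable lebesgue"
    using hdot by (simp add: L2_unit_def set_borel_measurable_def)
  then have "(\<lambda>u. (indicator {0..1} u *\<^sub>R hdot u) $ i) \<in> borel_measurable lebesgue"
    by (rule borel_measurable_continuous_on[OF linear_continuous_on[OF bounded_linear_vec_nth]])
  then have "(\<lambda>u. fbm_const H * (indicator {0..1} u *\<^sub>R hdot u) $ i) \<in> borel_measurable lebesgue"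
    by measurable
  also have "(\<lambda>u. fbm_const H * (indicator {0..1} u *\<^sub>R hdot u) $ i) = g i"
    by (auto simp: g_def)
  finally show meas: "g i \<in> borel_measurable lebesgue" .
  have "integrable lebesgue (\<lambda>u. (fbm_const H)\<^sup>2 * (indicator {0..1} u * (norm (hdot u))\<^sup>2))"
    using hdot by (intro integrable_mult_right) (simp add: L2_unit_def set_integrable_def)
  then show "integrable lebesgue (\<lambda>u. (g i u)\<^sup>2)"
  proof (rule Bochner_Integration.integrable_bound)
    have "(hdot u $ i)\<^sup>2 \<le> (norm (hdot u))\<^sup>2" for u
      using component_le_norm_cart[of "hdot u" i] by (simp add: abs_le_square_iff[symmetric])
    then show "AE u in lebesgue. norm ((g i u)\<^sup>2) \<le> norm ((fbm_const H)\<^sup>2 * (indicator {0..1} u * (norm (hdot u))\<^sup>2))"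
      by (auto simp: g_def power_mult_distrib indicator_def intro!: AE_I2 mult_left_mono)
  qed (use meas in measurable)
qed

text \<open>\<open>K\<^sup>*\<close> maps the indicator of \<open>[0,t]\<close> to the kernel at
  time \<open>t\<close>, so a component of \<open>K hdot\<close> is the pairing of the constant
  \<open>1\<close> with the rescaled \<open>hdot\<close>.\<close>

lemma (in kernel_exponent) fbm_operator_nth:
  fixes hdot :: "real \<Rightarrow> real ^ 'd" and i :: 'd
  defines "g \<equiv> \<lambda>u. indicator {0..1} u * (fbm_const (1/2 - a) * hdot u $ i)"
  assumes hdot: "hdot \<in> L2_unit" and t: "t \<in> {0..1}"
  shows "fbm_operator (1/2 - a) hdot t $ i = star_pairing a g (\<lambda>_. 1) t"
proof -
  let ?c = "fbm_const (1/2 - a)"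
  have eq: "indicator {0..t} s *\<^sub>R ((fbm_kernel (1/2 - a) t s *\<^sub>R hdot s) $ j)
      = vkernel a t s * (indicator {0..1} s * (?c * hdot s $ j))" for s j
    using t by (auto simp: fbm_kernel_eq indicator_def vkernel_def)
  have "set_integrable lebesgue {0..t} (\<lambda>s. (fbm_kernel (1/2 - a) t s *\<^sub>R hdot s) $ j)" for j
    unfolding set_integrable_def eq using t
    by (intro integrable_vkernel L2_unit_nth_measurable[OF hdot] L2_unit_nth_square[OF hdot]) auto
  then have "fbm_operator (1/2 - a) hdot t $ i = (LINT s:{0..t}|lebesgue. (fbm_kernel (1/2 - a) t s *\<^sub>R hdot s) $ i)"
    unfolding fbm_operator_def by (rule LINT_vec_nth)
  also have "\<dots> = star_pairing a g (\<lambda>_. 1) t"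
    unfolding set_lebesgue_integral_def eq star_pairing_def vstar_const g_def ..
  finally show ?thesis .
qed

lemma (in kernel_exponent) LINT_Kstar_between:
  fixes hdot :: "real \<Rightarrow> real ^ 'd" and i :: 'd
  defines "g \<equiv> \<lambda>u. indicator {0..1} u * (fbm_const (1/2 - a) * hdot u $ i)"
  assumes hdot: "hdot \<in> L2_unit" and f': "holder_le a C f'" "\<And>r. r \<in> {0..1} \<Longrightarrow> f' r = f r"
    and t: "0 \<le> s" "s \<le> t" "t \<le> 1"
  shows "(LINT u:{0..1}|lebesgue. Kstar_between (1/2 - a) f s t u * hdot u $ i)
    = star_pairing a g f' t - star_pairing a g f' s"
proof -
  have m: "f' \<in> borel_measurable borel" using f' by (simp add: holder_le_def)
  have K: "Kstar_upto (1/2 - a) f r u = fbm_const (1/2 - a) * vstar a f' r u" if "r \<le> 1" "0 \<le> u" for r u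
    using Kstar_upto_eq[OF m f'(2)] that by simp
  have g: "g \<in> borel_measurable lebesgue" "integrable lebesgue (\<lambda>u. (g u)\<^sup>2)"
    unfolding g_def by (rule L2_unit_nth_measurable[OF hdot] L2_unit_nth_square[OF hdot])+
  have int: "integrable lebesgue (\<lambda>u. vstar a f' r u * g u)" if "0 \<le> r" "r \<le> 1" for r
    using that by (intro integrable_vstar[OF oscillation_le_of_holder[OF f'(1)] _ _ jumps_le_none g, where A=0]) auto
  have "(LINT u:{0..1}|lebesgue. Kstar_between (1/2 - a) f s t u * hdot u $ i)
      = (LINT u|lebesgue. vstar a f' t u * g u - vstar a f' s u * g u)"
    unfolding set_lebesgue_integral_def using t
    by (intro Bochner_Integration.integral_cong refl) (auto simp: g_def Kstar_between_def K indicator_def algebra_simps)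
  also have "\<dots> = star_pairing a g f' t - star_pairing a g f' s"
    unfolding star_pairing_def using t by (intro Bochner_Integration.integral_diff int) auto
  finally show ?thesis .
qed

theorem theorem9:
  fixes H p :: real
    and h hdot :: "real \<Rightarrow> real ^ 'd"
    and X :: "'d::finite rough_path"
    and i j k :: 'd
    and s t :: real
  assumes "1/4 < H" and "H < 1/2"
    and "1 < p" and "p < 4" and "1 < p * H"
    and "hdot \<in> L2_unit" and "\<forall>r\<in>{0..1}. h r = fbm_operator H hdot r"
    and "geometric_rough_path_above p h X"
    and "0 \<le> s" and "s < t" and "t \<le> 1"
  shows "level2 X s t $ i $ j =
           (LINT u:{0..1}|lebesgue. Kstar_between H (\<lambda>r. level1 X 0 r $ i) s t u * hdot u $ j)
           - level1 X 0 s $ i * level1 X s t $ j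
         \<and> level3 X s t $ i $ j $ k =
           (LINT u:{0..1}|lebesgue. Kstar_between H (\<lambda>r. level2 X 0 r $ i $ j) s t u * hdot u $ k)
           - level2 X 0 s $ i $ j * level1 X s t $ k
           - level1 X 0 s $ i * level2 X s t $ j $ k"
proof -
  define a where "a = 1/2 - H"
  have H: "H = 1/2 - a" by (simp add: a_def)
  interpret kernel_exponent a
    using assms(1,2) by unfold_locales (auto simp: a_def)
  define g where "g i u = indicator {0..1} u * (fbm_const (1/2 - a) * hdot u $ i)" for i u
  have g_meas: "g i \<in> borel_measurable lebesgue" and g_square: "integrable lebesgue (\<lambda>u. (g i u)\<^sup>2)" for i
    unfolding g_def[abs_def] by (rule L2_unit_nth_measurable[OF assms(6)] L2_unit_nth_square[OF assms(6)])+
  interpret P: square_integrable_pairing a "g l" for l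
    by unfold_locales (rule g_meas g_square)+
  define y where "y i = star_pairing a (g i) (\<lambda>_. 1)" for i
  have h: "h r $ i = y i r" if "r \<in> {0..1}" for r i
    using assms(7) fbm_operator_nth[OF assms(6) that, of i] that by (simp add: H y_def g_def[abs_def])
  define F1 where "F1 m i r = (if r \<in> {0..1} then dyadic_integral m (y i) (\<lambda>_. 1) r else 0)" for m i r
  define F2 where "F2 m i j r = (if r \<in> {0..1} then dyadic_integral m (y j) (F1 m i) r else 0)" for m i j r
  let ?J1 = "\<lambda>m i. slope_integral1 m (\<lambda>r. h r $ i)"
  let ?J2 = "\<lambda>m i j. slope_integral2 m (\<lambda>r. h r $ i) (\<lambda>r. h r $ j)"
  let ?J3 = "\<lambda>m i j k. slope_integral3 m (\<lambda>r. h r $ i) (\<lambda>r. h r $ j) (\<lambda>r. h r $ k)"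
  have J: "?J1 m i 0 r = F1 m i r" "?J2 m i j 0 r = F2 m i j r"
      "?J3 m i j k 0 r = dyadic_integral m (y k) (F2 m i j) r" if "r \<in> {0..1}" for m i j k r
    using slope_integral_eq_dyadic_integral[where x="\<lambda>r. h r $ i" and x'="y i" and y="\<lambda>r. h r $ j" and y'="y j"
      and z="\<lambda>r. h r $ k" and z'="y k" and m=m, OF h h h that]
    by (simp_all only: F1_def[abs_def] F2_def[abs_def])
  have L1: "(\<lambda>m. ?J1 m i q r) \<longlonglongrightarrow> level1 X q r $ i"
    and L2: "(\<lambda>m. ?J2 m i j q r) \<longlonglongrightarrow> level2 X q r $ i $ j"
    and L3: "(\<lambda>m. ?J3 m i j k q r) \<longlonglongrightarrow> level3 X q r $ i $ j $ k"
    if "0 \<le> q" "q \<le> r" "r \<le> 1" for q r i j k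
    using assms(8) that unfolding geometric_rough_path_above_def canonical_lift_def
    by (auto simp flip: iterated_integral1_nth iterated_integral2_nth iterated_integral3_nth intro!: tendsto_vec_nth)
  \<comment> \<open>Two rounds of \<open>holder_le_dyadic_integral\<close>, starting from the
    constant \<open>1\<close> of \<open>holder_le_const\<close>; neither bound depends on
    \<open>m\<close>.\<close>
  define C1 where "C1 i = 5 * 1 * P.pairing_const i + 1" for i
  define C2 where "C2 i j = 5 * C1 i * P.pairing_const j + 1" for i j
  have F1: "holder_le a (C1 i) (F1 m i)" for m i
    unfolding C1_def F1_def[abs_def] y_def by (rule P.holder_le_dyadic_integral[OF holder_le_const])
  have F2: "holder_le a (C2 i j) (F2 m i j)" for m i j
    unfolding C2_def F2_def[abs_def] y_def by (rule P.holder_le_dyadic_integral[OF F1])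
  \<comment> \<open>The levels of \<open>X\<close> are unspecified outside \<open>[0,1]\<close>. Cut
    off, they are pointwise limits of \<open>F1\<close> and \<open>F2\<close> and inherit Borel
    measurability and the Hoelder bound.\<close>
  define G1 where "G1 i r = (if r \<in> {0..1} then level1 X 0 r $ i else 0)" for i r
  define G2 where "G2 i j r = (if r \<in> {0..1} then level2 X 0 r $ i $ j else 0)" for i j r
  have lim1: "(\<lambda>m. F1 m i r) \<longlonglongrightarrow> G1 i r" for i r
    using L1[of 0 r i] by (cases "r \<in> {0..1}") (auto simp: J G1_def F1_def)
  have lim2: "(\<lambda>m. F2 m i j r) \<longlonglongrightarrow> G2 i j r" for i j r
    using L2[of 0 r i j] by (cases "r \<in> {0..1}") (auto simp: J G2_def F2_def)
  have meas1: "G1 i \<in> borel_measurable borel" for i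
    using F1 by (intro borel_measurable_LIMSEQ_real[OF lim1]) (auto simp: holder_le_def)
  have meas2: "G2 i j \<in> borel_measurable borel" for i j
    using F2 by (intro borel_measurable_LIMSEQ_real[OF lim2]) (auto simp: holder_le_def)
  have G1: "holder_le a (C1 i) (G1 i)" and G2: "holder_le a (C2 i j) (G2 i j)" for i j
    using P.holder_le_limit[OF F1 meas1 lim1] P.holder_le_limit[OF F2 meas2 lim2] by auto
  \<comment> \<open>One sequence has two limits: the level of \<open>X\<close> by assumption, and
    the pairing by \<open>dyadic_integral_tendsto\<close>.\<close>
  have level2_eq: "level2 X 0 r $ i $ j = star_pairing a (g j) (G1 i) r" if "r \<in> {0..1}" for r i j
  proof (rule LIMSEQ_unique)
    show "(\<lambda>m. F2 m i j r) \<longlonglongrightarrow> star_pairing a (g j) (G1 i) r"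
      using P.dyadic_integral_tendsto[OF F1 meas1 lim1, of r j] that by (simp add: F2_def y_def)
    show "(\<lambda>m. F2 m i j r) \<longlonglongrightarrow> level2 X 0 r $ i $ j"
      using lim2[of i j r] that by (simp add: G2_def)
  qed
  have level3_eq: "level3 X 0 r $ i $ j $ k = star_pairing a (g k) (G2 i j) r" if "r \<in> {0..1}" for r i j k
  proof (rule LIMSEQ_unique)
    show "(\<lambda>m. ?J3 m i j k 0 r) \<longlonglongrightarrow> star_pairing a (g k) (G2 i j) r"
      using P.dyadic_integral_tendsto[OF F2 meas2 lim2, of r k] that by (simp add: J y_def)
    show "(\<lambda>m. ?J3 m i j k 0 r) \<longlonglongrightarrow> level3 X 0 r $ i $ j $ k"
      using L3 that by simp
  qed
  have st: "0 \<le> s" "s \<le> t" "t \<le> 1" "s \<in> {0..1}" "t \<in> {0..1}" using assms by auto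
  \<comment> \<open>Chen's relation for \<open>X\<close> is inherited from the lifts in the limit.
    It turns the increment from \<open>s\<close> to \<open>t\<close> of the levels based at
    \<open>0\<close> into the level over \<open>s\<close>, \<open>t\<close> plus the correction
    terms.\<close>
  have chen2: "level2 X 0 t $ i $ j = level2 X 0 s $ i $ j + level1 X 0 s $ i * level1 X s t $ j + level2 X s t $ i $ j"
  proof (rule LIMSEQ_unique[OF L2])
    show "(\<lambda>m. ?J2 m i j 0 t) \<longlonglongrightarrow> level2 X 0 s $ i $ j + level1 X 0 s $ i * level1 X s t $ j + level2 X s t $ i $ j"
      unfolding slope_integral2_split[OF order_refl st(1-3)] using st by (intro tendsto_intros L1 L2) auto
  qed (use st in auto)
  have chen3: "level3 X 0 t $ i $ j $ k = level3 X 0 s $ i $ j $ k + level2 X 0 s $ i $ j * level1 X s t $ k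
      + level1 X 0 s $ i * level2 X s t $ j $ k + level3 X s t $ i $ j $ k"
  proof (rule LIMSEQ_unique[OF L3])
    show "(\<lambda>m. ?J3 m i j k 0 t) \<longlonglongrightarrow> level3 X 0 s $ i $ j $ k + level2 X 0 s $ i $ j * level1 X s t $ k
      + level1 X 0 s $ i * level2 X s t $ j $ k + level3 X s t $ i $ j $ k"
      unfolding slope_integral3_split[OF order_refl st(1-3)] using st by (intro tendsto_intros L1 L2 L3) auto
  qed (use st in auto)
  have "(LINT u:{0..1}|lebesgue. Kstar_between H (\<lambda>r. level1 X 0 r $ i) s t u * hdot u $ j)
      = level2 X 0 t $ i $ j - level2 X 0 s $ i $ j"
    unfolding level2_eq[OF st(4)] level2_eq[OF st(5)] unfolding H g_def[abs_def]
    by (rule LINT_Kstar_between[OF assms(6) G1 _ st(1-3)]) (simp add: G1_def)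
  moreover have "(LINT u:{0..1}|lebesgue. Kstar_between H (\<lambda>r. level2 X 0 r $ i $ j) s t u * hdot u $ k)
      = level3 X 0 t $ i $ j $ k - level3 X 0 s $ i $ j $ k"
    unfolding level3_eq[OF st(4)] level3_eq[OF st(5)] unfolding H g_def[abs_def]
    by (rule LINT_Kstar_between[OF assms(6) G2 _ st(1-3)]) (simp add: G2_def)
  ultimately show ?thesis
    by (simp add: chen2 chen3)
qed

end
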